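(* Let $T>0$ and let $\{u^\varepsilon(\cdot,t)\}$ be a family of approximate solutions of the 3D incompressible Euler equations on $[0,T]$. Assume that the corresponding vorticities $\{\boldsymbol\omega^\varepsilon(\cdot,t)\}$ are compactly supported and satisfy the following local alignment condition: writing $\boldsymbol\xi^\varepsilon(x,t):=\boldsymbol\omega^\varepsilon(x,t)/|\boldsymbol\omega^\varepsilon(x,t)|$ where $\boldsymbol\omega^\varepsilon(x,t)\neq0$, there exist constants $K_0>0$, $\delta>0$ and $\theta=\theta_\delta<1$ such that whenever $|\boldsymbol\omega^\varepsilon(x,t)|,|\boldsymbol\omega^\varepsilon(y,t)|>K_0$ and $|x-y|\le\delta$ there holds $$|\boldsymbol\xi^\varepsilon(x,t)-\boldsymbol\xi^\varepsilon(y,t)|\le\sqrt2\,\theta .$$ Then for every $\Omega\subset\mathbb{R}^3$ there is a constant $\mathrm{Const}_T$, independent of $\varepsilon$, such that $$\|\boldsymbol\omega^\varepsilon(\cdot,t)\|_{V^{\frac65 2}(\Omega)}\le \mathrm{Const}_T,\qquad t\le T .$$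
   Context: Euler equations: $u_t+u\cdot\nabla u=-\nabla p$, $\operatorname{div}u=0$ in $\mathbb{R}^N$ (here $N=3$), with prescribed initial data. Approximate solutions on $[0,T]$: a family of velocity fields $\{u^\varepsilon\}$ with $\operatorname{div}u^\varepsilon=0$, uniformly bounded in $L^\infty([0,T];L^2_{\mathrm{loc}}(\mathbb{R}^N))\cap \mathrm{Lip}((0,T);H^{-L}_{\mathrm{loc}}(\mathbb{R}^N))$ for some $L>1$, such that for every vector field $\Phi\in C_c^\infty([0,T)\times\mathbb{R}^N)$ with $\operatorname{div}\Phi=0$, $$\int_0^T\!\!\int_{\mathbb{R}^N}\Phi_t\cdot u^\varepsilon+(D\Phi\,u^\varepsilon)\cdot u^\varepsilon\,dx\,dt+\int_{\mathbb{R}^N}\Phi(x,0)\cdot u^\varepsilon(x,0)\,dx\longrightarrow0\quad(\varepsilon\to0).$$ The vorticity is $\boldsymbol\omega^\varepsilon=\nabla\times u^\varepsilon$. The space $V^{\frac65 2}(\Omega)$, $\Omega\subset\mathbb{R}^3$ (the space $V^{pq}$ with $p=6/5$, $q=2$): for fixed sufficiently small $R_0<1/2$, $$\|f\|^2_{V^{\frac65 2}(\Omega)}:=\sup\sum_j\frac1{R_j}\Big(\int_{B_j}|f(x)|\,dx\Big)^2 ,$$ the supremum being over all collections of mutually disjoint balls $B_j=B_{R_j}(x_j)\subset\Omega$ with $R_j\le R_0$.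
   Formalization: The bound is stated for bounded Ω, or for every Ω when all vorticities are supported in one common compact set; if the supports may escape to infinity as ε→0, the claim for unbounded Ω fails (many far-apart translates of one weak stationary vortex). *)

theory Defs
  imports "HOL-Analysis.Analysis"
begin

(* Test functions. C^k is defined through iterated directional derivatives: each of them is again
   Frechet differentiable (hence continuous), so this is the usual notion. *)

primrec Ck :: "nat \<Rightarrow> ('a::euclidean_space \<Rightarrow> 'b::real_normed_vector) \<Rightarrow> bool" where
  "Ck 0 f \<longleftrightarrow> continuous_on UNIV f"
| "Ck (Suc k) f \<longleftrightarrow> (\<forall>x. f differentiable (at x)) \<and>
      (\<forall>v. Ck k (\<lambda>x. frechet_derivative f (at x) v))"

definition smooth :: "('a::euclidean_space \<Rightarrow> 'b::real_normed_vector) \<Rightarrow> bool" where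
  "smooth f \<longleftrightarrow> (\<forall>k. Ck k f)"

definition support_of :: "('a::topological_space \<Rightarrow> 'b::zero) \<Rightarrow> 'a set" where
  "support_of f = closure {x. f x \<noteq> 0}"

definition test_function :: "('a::euclidean_space \<Rightarrow> 'b::real_normed_vector) \<Rightarrow> bool" where
  "test_function f \<longleftrightarrow> smooth f \<and> compact (support_of f)"

(* C_c^infinity([0,T) x R^3): the restrictions to t >= 0 of the members of
   C_c^infinity((-infinity,T) x R^3). Values at negative times are irrelevant, and in particular
   the divergence is only required to vanish on [0,T). *)

definition solenoidal_test_field :: "real \<Rightarrow> (real \<times> (real^3) \<Rightarrow> real^3) \<Rightarrow> bool" where
  "solenoidal_test_field T \<Phi> \<longleftrightarrow> test_function \<Phi> \<and> (\<forall>(t, x) \<in> support_of \<Phi>. t < T) \<and>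
     (\<forall>t x. 0 \<le> t \<and> t < T \<longrightarrow>
        (\<Sum>i\<in>UNIV. frechet_derivative \<Phi> (at (t, x)) (0, axis i 1) $ i) = 0)"

definition curl :: "(real^3 \<Rightarrow> real^3) \<Rightarrow> real^3 \<Rightarrow> real^3" where
  "curl \<Psi> x = (let d = (\<lambda>i j. frechet_derivative \<Psi> (at x) (axis i 1) $ j) in
     vector [d 2 3 - d 3 2, d 3 1 - d 1 3, d 1 2 - d 2 1])"

definition grad :: "(real^3 \<Rightarrow> real) \<Rightarrow> real^3 \<Rightarrow> real^3" where
  "grad \<phi> x = (\<chi> i. frechet_derivative \<phi> (at x) (axis i 1))"

definition L1_loc :: "(real^3 \<Rightarrow> real^3) \<Rightarrow> bool" where
  "L1_loc f \<longleftrightarrow> (\<forall>K. compact K \<longrightarrow> set_integrable lebesgue K f)"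

definition L2_loc :: "(real^3 \<Rightarrow> real^3) \<Rightarrow> bool" where
  "L2_loc f \<longleftrightarrow> f \<in> borel_measurable lebesgue \<and>
     (\<forall>K. compact K \<longrightarrow> set_integrable lebesgue K (\<lambda>x. (norm (f x))\<^sup>2))"

(* div v = 0 and w = curl v in the sense of distributions *)

definition divergence_free :: "(real^3 \<Rightarrow> real^3) \<Rightarrow> bool" where
  "divergence_free v \<longleftrightarrow>
     (\<forall>\<phi>. test_function \<phi> \<longrightarrow> (LINT x|lebesgue. v x \<bullet> grad \<phi> x) = 0)"

definition is_vorticity :: "(real^3 \<Rightarrow> real^3) \<Rightarrow> (real^3 \<Rightarrow> real^3) \<Rightarrow> bool" where
  "is_vorticity v w \<longleftrightarrow> L1_loc w \<and>
     (\<forall>\<Psi>. test_function \<Psi> \<longrightarrow>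
        (LINT x|lebesgue. w x \<bullet> \<Psi> x) = (LINT x|lebesgue. v x \<bullet> curl \<Psi> x))"

(* Sobolev norms. H^L is normed through the Fourier transform, up to the constant factor
   (2 pi)^3 in the square, and H^{-L} is its dual, normed on vector fields f that act by
   integration. *)

definition fourier :: "(real^3 \<Rightarrow> real) \<Rightarrow> real^3 \<Rightarrow> complex" where
  "fourier g \<eta> = (LINT x|lebesgue. of_real (g x) * cis (- (x \<bullet> \<eta>)))"

definition H_norm_sq :: "real \<Rightarrow> (real^3 \<Rightarrow> real^3) \<Rightarrow> ennreal" where
  "H_norm_sq L \<phi> = (\<integral>\<^sup>+ \<eta>. ennreal ((1 + (norm \<eta>)\<^sup>2) powr L *
     (\<Sum>i\<in>UNIV. (cmod (fourier (\<lambda>x. \<phi> x $ i) \<eta>))\<^sup>2)) \<partial>lebesgue)"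

definition H_neg_norm :: "real \<Rightarrow> (real^3 \<Rightarrow> real^3) \<Rightarrow> ennreal" where
  "H_neg_norm L f =
     (SUP \<phi> \<in> {\<phi>. test_function \<phi> \<and> H_norm_sq L \<phi> \<le> 1}. ennreal \<bar>LINT x|lebesgue. f x \<bullet> \<phi> x\<bar>)"

definition bounded_Linf_L2_loc ::
  "real \<Rightarrow> 'i set \<Rightarrow> ('i \<Rightarrow> real \<Rightarrow> real^3 \<Rightarrow> real^3) \<Rightarrow> bool" where
  "bounded_Linf_L2_loc T E u \<longleftrightarrow>
     (\<forall>\<epsilon>\<in>E. case_prod (u \<epsilon>) \<in> borel_measurable (lebesgue_on {p. 0 \<le> fst p \<and> fst p \<le> T})) \<and>
     (\<forall>K. compact K \<longrightarrow> (\<exists>M::real. \<forall>\<epsilon>\<in>E. AE t in lebesgue_on {0..T}.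
        (\<integral>\<^sup>+ x\<in>K. ennreal ((norm (u \<epsilon> t x))\<^sup>2) \<partial>lebesgue) \<le> ennreal M))"

(* A Lipschitz map on (0,T) has a unique Lipschitz extension to [0,T]; stating the estimate on
   [0,T] says that u(.,0) and u(.,T) are the values of this extension. Membership in the local
   space is tested with cut-offs \<zeta>. *)

definition bounded_Lip_H_neg_loc ::
  "real \<Rightarrow> real \<Rightarrow> 'i set \<Rightarrow> ('i \<Rightarrow> real \<Rightarrow> real^3 \<Rightarrow> real^3) \<Rightarrow> bool" where
  "bounded_Lip_H_neg_loc T L E u \<longleftrightarrow>
     (\<forall>\<zeta> :: real^3 \<Rightarrow> real. test_function \<zeta> \<longrightarrow>
        (\<exists>M::real. \<forall>\<epsilon>\<in>E. \<forall>s\<in>{0..T}. \<forall>t\<in>{0..T}.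
           H_neg_norm L (\<lambda>x. \<zeta> x *\<^sub>R (u \<epsilon> t x - u \<epsilon> s x)) \<le> ennreal (M * \<bar>t - s\<bar>)))"

(* Here frechet_derivative \<Phi> (at (t, x)) (1, 0) is \<Phi>_t and
   frechet_derivative \<Phi> (at (t, x)) (0, v) is D\<Phi> v. *)

definition weak_residual ::
  "real \<Rightarrow> (real \<Rightarrow> real^3 \<Rightarrow> real^3) \<Rightarrow> (real \<times> (real^3) \<Rightarrow> real^3) \<Rightarrow> real" where
  "weak_residual T v \<Phi> =
     (LINT t:{0..T}|lebesgue. LINT x|lebesgue.
        frechet_derivative \<Phi> (at (t, x)) (1, 0) \<bullet> v t x +
        frechet_derivative \<Phi> (at (t, x)) (0, v t x) \<bullet> v t x) +
     (LINT x|lebesgue. \<Phi> (0, x) \<bullet> v 0 x)"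

(* The parameter \<epsilon> ranges over a set E of positive reals accumulating at 0, which covers both
   full families and sequences. *)

definition approximate_solutions ::
  "real \<Rightarrow> real set \<Rightarrow> (real \<Rightarrow> real \<Rightarrow> real^3 \<Rightarrow> real^3) \<Rightarrow> bool" where
  "approximate_solutions T E u \<longleftrightarrow>
     E \<subseteq> {0<..} \<and> 0 islimpt E \<and>
     (\<forall>\<epsilon>\<in>E. \<forall>t\<in>{0..T}. L2_loc (u \<epsilon> t) \<and> divergence_free (u \<epsilon> t)) \<and>
     bounded_Linf_L2_loc T E u \<and>
     (\<exists>L>1. bounded_Lip_H_neg_loc T L E u) \<and>
     (\<forall>\<Phi>. solenoidal_test_field T \<Phi> \<longrightarrow>
        ((\<lambda>\<epsilon>. weak_residual T (u \<epsilon>) \<Phi>) \<longlongrightarrow> 0) (at 0 within E))"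

definition direction :: "real^3 \<Rightarrow> real^3" where
  "direction w = w /\<^sub>R norm w"

definition locally_aligned ::
  "real \<Rightarrow> 'i set \<Rightarrow> ('i \<Rightarrow> real \<Rightarrow> real^3 \<Rightarrow> real^3) \<Rightarrow> bool" where
  "locally_aligned T E \<omega> \<longleftrightarrow>
     (\<exists>K0>0. \<exists>\<delta>>0. \<exists>\<theta><1. \<forall>\<epsilon>\<in>E. \<forall>t\<in>{0..T}. \<forall>x y.
        norm (\<omega> \<epsilon> t x) > K0 \<and> norm (\<omega> \<epsilon> t y) > K0 \<and> dist x y \<le> \<delta> \<longrightarrow>
        norm (direction (\<omega> \<epsilon> t x) - direction (\<omega> \<epsilon> t y)) \<le> sqrt 2 * \<theta>)"

(* The V^{6/5,2} norm. A collection of balls is a set of (centre, radius) pairs; being disjoint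
   and nonempty open sets, the balls of a collection are at most countably many. *)

definition ball_collection :: "real \<Rightarrow> (real^3) set \<Rightarrow> ((real^3) \<times> real) set \<Rightarrow> bool" where
  "ball_collection R\<^sub>0 \<Omega> \<B> \<longleftrightarrow>
     (\<forall>(x, R)\<in>\<B>. 0 < R \<and> R \<le> R\<^sub>0 \<and> ball x R \<subseteq> \<Omega>) \<and>
     disjoint_family_on (\<lambda>(x, R). ball x R) \<B>"

definition V_norm_sq :: "real \<Rightarrow> (real^3) set \<Rightarrow> (real^3 \<Rightarrow> real^3) \<Rightarrow> ennreal" where
  "V_norm_sq R\<^sub>0 \<Omega> f = (SUP \<B> \<in> {\<B>. ball_collection R\<^sub>0 \<Omega> \<B>}.
     \<Sum>\<^sub>\<infinity>(x, R)\<in>\<B>. ennreal (1 / R) * (\<integral>\<^sup>+ y\<in>ball x R. ennreal (norm (f y)) \<partial>lebesgue)\<^sup>2)"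

definition V_norm :: "real \<Rightarrow> (real^3) set \<Rightarrow> (real^3 \<Rightarrow> real^3) \<Rightarrow> ennreal" where
  "V_norm R\<^sub>0 \<Omega> f =
     (if V_norm_sq R\<^sub>0 \<Omega> f = \<infinity> then \<infinity> else ennreal (sqrt (enn2real (V_norm_sq R\<^sub>0 \<Omega> f))))"

end

(*
  On a ball B of radius R <= delta / 4 the large vorticity vectors on the doubled ball
  2B lie in a cone of half-angle less than pi/2 around a single unit vector e, so that, up to a
  bounded error, |w| is dominated by w . e there. Testing the vorticity with a smooth bump phi on
  2B in the direction e gives

    int_B |w| <= C |int u . curl (phi e)| + C R^3 <= (C / R) int_{2B} |u| + C R^3.

  For disjoint balls B_j the doubled balls can overlap without bound, hence the Cauchy-Schwarz
  inequality on each 2B_j is too lossy. Instead R^(-3) int_{2B} |u| is bounded on B by the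
  Hardy-Littlewood maximal function of u, and the L^2 maximal inequality bounds
  sum_j R_j^(-3) (int_{2B_j} |u|)^2 by the local energy.

  The energy bound holds for almost every time only. It passes to all times because the pairings
  int u(t) . curl (phi e) are continuous in t by the Lipschitz bound in H^(-L). For this the test
  functions need finite H^L norm, that is, decay of their Fourier transforms.
*)
theory Submission
  imports Defs
begin

section \<open>The maximal inequality for doubled balls\<close>

text \<open>The direction on a ball depends on the vorticity at the given time, whereas continuity
  in time is available only for pairings with a fixed field. The bound on the pairings is therefore
  proved for arbitrary vectors of norm at most 1, one for each ball: with a finite collection and
  its vectors frozen, the sum of squares is continuous in time, and directions adapted to one
  instant may be kept while the time varies.

  Alignment is a local condition and says nothing about balls of radius above
  \<open>\<delta> / 4\<close>. These are reached through the total mass: a bounded region is covered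
  by finitely many balls of a small radius \<open>\<rho>\<close>, each of which alone is a
  collection to which the small-ball bound applies. This bounds the mass of the region, and a larger
  ball then costs at most a factor 1 / \<rho>.

  All estimates are local in space, so a uniform constant requires one fixed ball containing every
  ball that carries vorticity.\<close>

lemma ball_in_sets_borel [measurable]: "ball x r \<in> sets borel"
  by simp

lemma emeasure_ball_scale:
  fixes x :: "'a::euclidean_space"
  assumes "0 \<le> R" "0 \<le> k"
  shows "emeasure lborel (ball x (k * R)) = ennreal (k ^ DIM('a)) * emeasure lborel (ball x R)"
  using emeasure_lebesgue_ball_conv_unit_ball[of "k * R" x] emeasure_lebesgue_ball_conv_unit_ball[of R x] assms
  by (simp add: power_mult_distrib ennreal_mult mult.assoc)

text \<open>The parts of \<open>g\<close> below level \<open>\<tau> / (2 * 2 ^ DIM('a))\<close> contribute at most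
  \<open>\<tau> / 2\<close> to each average over a doubled ball, and a disjoint Vitali subfamily of the doubled
  balls controls the measure of all the balls.\<close>

lemma doubled_ball_averages_weak_type:
  fixes g :: "'a::euclidean_space \<Rightarrow> ennreal" and \<B> :: "('a \<times> real) set"
  assumes [measurable]: "g \<in> borel_measurable borel"
    and fin: "finite \<B>" and pos: "\<And>x R. (x, R) \<in> \<B> \<Longrightarrow> 0 < R"
    and disj: "disjoint_family_on (\<lambda>(x, R). ball x R) \<B>"
    and \<tau>: "0 < \<tau>"
    and large: "\<And>x R. (x, R) \<in> \<B> \<Longrightarrow>
       ennreal \<tau> * emeasure lborel (ball x R) \<le> (\<integral>\<^sup>+ y\<in>ball x (2 * R). g y \<partial>lborel)"
  shows "ennreal \<tau> * (\<Sum>(x, R)\<in>\<B>. emeasure lborel (ball x R)) \<le>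
    ennreal (2 * 10 ^ DIM('a)) *
      (\<integral>\<^sup>+ y. g y * indicator {y. ennreal (\<tau> / (2 * 2 ^ DIM('a))) < g y} y \<partial>lborel)"
proof -
  define l where "l = \<tau> / (2 * 2 ^ DIM('a))"
  define G where "G = {y. ennreal l < g y}"
  have [measurable]: "G \<in> sets borel" unfolding G_def by measurable
  have l: "0 < l" using \<tau> by (simp add: l_def)
  have part: "ennreal (\<tau> / 2) * emeasure lborel (ball x R) \<le> (\<integral>\<^sup>+ y\<in>ball x (2 * R). (g y * indicator G y) \<partial>lborel)"
    if "(x, R) \<in> \<B>" for x R
  proof -
    let ?m = "emeasure lborel (ball x R)"
    have R: "0 < R" using pos that .
    have "g y \<le> g y * indicator G y + ennreal l" for y
      by (auto simp: G_def indicator_def)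
    then have "(\<integral>\<^sup>+ y\<in>ball x (2 * R). g y \<partial>lborel) \<le>
        (\<integral>\<^sup>+ y. g y * indicator G y * indicator (ball x (2 * R)) y + ennreal l * indicator (ball x (2 * R)) y \<partial>lborel)"
      by (intro nn_integral_mono) (auto simp: indicator_def)
    also have "\<dots> = (\<integral>\<^sup>+ y\<in>ball x (2 * R). (g y * indicator G y) \<partial>lborel) + ennreal l * emeasure lborel (ball x (2 * R))"
      by (simp add: nn_integral_add nn_integral_cmult_indicator)
    also have "ennreal l * emeasure lborel (ball x (2 * R)) = ennreal (l * 2 ^ DIM('a)) * ?m"
      using R l by (simp add: emeasure_ball_scale ennreal_mult mult.assoc)
    also have "l * 2 ^ DIM('a) = \<tau> / 2" by (simp add: l_def)
    finally have "ennreal (\<tau> / 2) * ?m + ennreal (\<tau> / 2) * ?m \<le>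
        (\<integral>\<^sup>+ y\<in>ball x (2 * R). (g y * indicator G y) \<partial>lborel) + ennreal (\<tau> / 2) * ?m"
      using large[OF that] \<tau> by (simp flip: distrib_right ennreal_plus)
    moreover have "ennreal (\<tau> / 2) * ?m < top"
      using emeasure_lborel_ball_finite[of x R] by (simp add: ennreal_mult_less_top)
    ultimately show ?thesis
      using ennreal_add_left_cancel_le[of "ennreal (\<tau> / 2) * ?m"] by (auto simp: add.commute)
  qed
  \<comment> \<open>Disjointness of the doubled balls is what lets their integrals add up to at most
    the integral of \<open>g\<close>; the original balls are only disjoint before doubling. The
    price is the enlargement by 5 * 2, hence the factor \<open>10 ^ DIM('a)\<close>.\<close>
  obtain C where C: "C \<subseteq> \<B>"
      "pairwise (\<lambda>i j. disjnt (cball (fst i) (2 * snd i)) (cball (fst j) (2 * snd j))) C"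
      "(\<Union>(x, R)\<in>\<B>. ball x R) \<subseteq> (\<Union>i\<in>C. cball (fst i) (5 * (2 * snd i)))"
  proof (rule Vitali_covering_lemma_cballs)
    show "(\<Union>(x, R)\<in>\<B>. ball x R) \<subseteq> (\<Union>i\<in>\<B>. cball (fst i) (2 * snd i))"
      using pos by (force simp: mem_ball mem_cball)
    show "0 < 2 * snd i \<and> 2 * snd i \<le> 2 * Max (snd ` \<B>)" if "i \<in> \<B>" for i
      using that pos[of "fst i" "snd i"] fin by auto
  qed auto
  have finC: "finite C" using C(1) fin finite_subset by blast
  have "(\<Sum>(x, R)\<in>\<B>. emeasure lborel (ball x R)) = emeasure lborel (\<Union>(x, R)\<in>\<B>. ball x R)"
    using sum_emeasure[of "\<lambda>(x, R). ball x R" \<B> lborel] disj fin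
    by (simp add: case_prod_unfold image_subset_iff)
  also have "\<dots> \<le> emeasure lborel (\<Union>i\<in>C. cball (fst i) (5 * (2 * snd i)))"
    using C(3) finC by (intro emeasure_mono) (auto intro!: sets.finite_UN)
  also have "\<dots> \<le> (\<Sum>i\<in>C. emeasure lborel (cball (fst i) (5 * (2 * snd i))))"
    by (intro emeasure_subadditive_finite finC) auto
  also have "\<dots> = ennreal (10 ^ DIM('a)) * (\<Sum>i\<in>C. emeasure lborel (ball (fst i) (snd i)))"
    unfolding sum_distrib_left
  proof (rule sum.cong)
    fix i assume "i \<in> C"
    then have "0 < snd i" using C(1) pos[of "fst i" "snd i"] by auto
    then show "emeasure lborel (cball (fst i) (5 * (2 * snd i))) =
      ennreal (10 ^ DIM('a)) * emeasure lborel (ball (fst i) (snd i))"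
      using emeasure_ball_scale[of "snd i" 10 "fst i"]
      by (simp add: emeasure_cball emeasure_ball)
  qed simp
  finally have "ennreal \<tau> * (\<Sum>(x, R)\<in>\<B>. emeasure lborel (ball x R)) \<le>
     ennreal \<tau> * (ennreal (10 ^ DIM('a)) * (\<Sum>i\<in>C. emeasure lborel (ball (fst i) (snd i))))"
    by (rule mult_left_mono) simp
  also have "\<dots> = ennreal (2 * 10 ^ DIM('a)) * (\<Sum>i\<in>C. ennreal (\<tau> / 2) * emeasure lborel (ball (fst i) (snd i)))"
  proof -
    have "ennreal \<tau> * ennreal (10 ^ DIM('a)) = ennreal (2 * 10 ^ DIM('a)) * ennreal (\<tau> / 2)"
      using \<tau> by (simp add: ennreal_mult[symmetric] del: ennreal_mult)
    then show ?thesis by (simp add: sum_distrib_left[symmetric] mult.assoc[symmetric])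
  qed
  also have "(\<Sum>i\<in>C. ennreal (\<tau> / 2) * emeasure lborel (ball (fst i) (snd i))) \<le>
      (\<Sum>i\<in>C. \<integral>\<^sup>+ y. g y * indicator G y * indicator (ball (fst i) (2 * snd i)) y \<partial>lborel)"
    using C(1) by (intro sum_mono part) auto
  also have "\<dots> = (\<integral>\<^sup>+ y. (\<Sum>i\<in>C. g y * indicator G y * indicator (ball (fst i) (2 * snd i)) y) \<partial>lborel)"
    by (intro nn_integral_sum[symmetric]) measurable
  also have "\<dots> \<le> (\<integral>\<^sup>+ y. g y * indicator G y \<partial>lborel)"
  proof (rule nn_integral_mono)
    fix y
    have "(\<Sum>i\<in>C. indicator (ball (fst i) (2 * snd i)) y :: ennreal) \<le> 1"
    proof (cases "\<exists>i\<in>C. y \<in> ball (fst i) (2 * snd i)")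
      case True
      then obtain i where i: "i \<in> C" "y \<in> ball (fst i) (2 * snd i)" by auto
      have "y \<notin> ball (fst j) (2 * snd j)" if "j \<in> C - {i}" for j
      proof
        assume "y \<in> ball (fst j) (2 * snd j)"
        moreover have "disjnt (cball (fst i) (2 * snd i)) (cball (fst j) (2 * snd j))"
          using C(2) i(1) that by (auto simp: pairwise_def)
        ultimately show False
          using i(2) ball_subset_cball by (meson disjnt_iff subsetD)
      qed
      then have "(\<Sum>j\<in>C - {i}. indicator (ball (fst j) (2 * snd j)) y :: ennreal) = 0"
        by (intro sum.neutral) (auto simp: indicator_def)
      then show ?thesis
        using i finC by (simp add: sum.remove[OF finC i(1)])
    next
      case False
      then show ?thesis by (simp add: indicator_def sum.neutral)
    qed
    then have "g y * indicator G y * (\<Sum>i\<in>C. indicator (ball (fst i) (2 * snd i)) y) \<le> g y * indicator G y * 1"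
      by (rule mult_left_mono) simp
    then show "(\<Sum>i\<in>C. g y * indicator G y * indicator (ball (fst i) (2 * snd i)) y) \<le> g y * indicator G y"
      by (simp add: sum_distrib_left)
  qed
  finally show ?thesis
    by (simp add: G_def l_def mult_left_mono)
qed

text \<open>Layer-cake formula for a square: squared averages become an integral over levels
  \<open>\<tau>\<close>, and at each level the weak-type bound applies to the balls whose average
  exceeds \<open>\<tau>\<close>.\<close>

lemma nn_integral_layer_square:
  assumes "0 \<le> m"
  shows "(\<integral>\<^sup>+ \<tau>. ennreal (2 * \<tau>) * indicator {0<..<m} \<tau> \<partial>lborel) = ennreal (m\<^sup>2)"
proof -
  have "(\<integral>\<^sup>+ \<tau>. ennreal (2 * \<tau>) * indicator {0<..<m} \<tau> \<partial>lborel)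
      = (\<integral>\<^sup>+ \<tau>. ennreal (2 * \<tau>) * indicator {0..m} \<tau> \<partial>lborel)"
  proof (rule nn_integral_cong_AE)
    show "AE \<tau> in lborel. ennreal (2 * \<tau>) * indicator {0<..<m} \<tau> = ennreal (2 * \<tau>) * indicator {0..m} \<tau>"
      using AE_lborel_singleton[of 0] AE_lborel_singleton[of m]
      by eventually_elim (auto simp: indicator_def)
  qed
  also have "\<dots> = ennreal (m\<^sup>2 - 0\<^sup>2)"
    by (rule nn_integral_FTC_Icc) (use assms in \<open>auto intro!: derivative_eq_intros\<close>)
  finally show ?thesis by simp
qed

text \<open>Interpolation in the manner of Marcinkiewicz: the truncation of \<open>g\<close> in the
  weak-type bound is what makes the integral over the levels finite. The averages over the doubled
  balls of the collection stand in for a maximal function, which is never defined.\<close>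

proposition doubled_ball_averages_strong_type:
  fixes g :: "'a::euclidean_space \<Rightarrow> ennreal" and \<B> :: "('a \<times> real) set"
  assumes [measurable]: "g \<in> borel_measurable borel"
    and fin: "finite \<B>" and pos: "\<And>x R. (x, R) \<in> \<B> \<Longrightarrow> 0 < R"
    and disj: "disjoint_family_on (\<lambda>(x, R). ball x R) \<B>"
  shows "(\<Sum>(x, R)\<in>\<B>. ennreal (1 / R ^ DIM('a)) * (\<integral>\<^sup>+ y\<in>ball x (2 * R). g y \<partial>lborel)\<^sup>2) \<le>
    ennreal (8 * 20 ^ DIM('a) * unit_ball_vol (DIM('a))) * (\<integral>\<^sup>+ y. (g y)\<^sup>2 \<partial>lborel)"
proof (cases "(\<integral>\<^sup>+ y. (g y)\<^sup>2 \<partial>lborel) = \<infinity>")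
  case True
  have "0 < unit_ball_vol (real DIM('a))" by simp
  then show ?thesis using True by (simp add: ennreal_mult_top del: unit_ball_vol_pos)
next
  case False
  define V where "V = unit_ball_vol (real DIM('a))"
  define a where "a = (\<lambda>(x, R). enn2real (\<integral>\<^sup>+ y\<in>ball x (2 * R). g y \<partial>lborel))"
  \<comment> \<open>Normalised by the volume of the ball itself, not of the doubled one, so that the
    hypothesis of the weak-type bound at level \<open>\<tau>\<close> reads
    \<open>\<tau> \<le> m p\<close>.\<close>
  define m where "m = (\<lambda>(x, R). a (x, R) / (V * R ^ DIM('a)))"
  have V: "0 < V" by (simp add: V_def)
  have ball: "emeasure lborel (ball x R) = ennreal (V * R ^ DIM('a))" if "0 < R" for x :: 'a and R
    using that by (simp add: emeasure_ball V_def)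
  \<comment> \<open>Square integrability makes the integral over a bounded ball finite, by t \<le> 1
    + t^2; the averages can then be handled as real numbers.\<close>
  have a: "(\<integral>\<^sup>+ y\<in>ball x (2 * R). g y \<partial>lborel) = ennreal (a (x, R))" for x R
  proof -
    have le: "t \<le> 1 + t\<^sup>2" for t :: ennreal
    proof (cases "t \<le> 1")
      case False
      then have "t * 1 \<le> t * t" by (intro mult_left_mono) auto
      then show ?thesis by (simp add: power2_eq_square add_increasing)
    qed (simp add: add_increasing2)
    have "(\<integral>\<^sup>+ y\<in>ball x (2 * R). g y \<partial>lborel) \<le> (\<integral>\<^sup>+ y. indicator (ball x (2 * R)) y + (g y)\<^sup>2 \<partial>lborel)"
      using le by (intro nn_integral_mono) (auto simp: indicator_def)
    also have "\<dots> = emeasure lborel (ball x (2 * R)) + (\<integral>\<^sup>+ y. (g y)\<^sup>2 \<partial>lborel)"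
      by (simp add: nn_integral_add)
    also have "\<dots> < \<infinity>"
      using False emeasure_lborel_ball_finite[of x "2 * R"] by (simp add: less_top)
    finally show ?thesis by (simp add: a_def)
  qed
  \<comment> \<open>At level \<open>\<tau>\<close> the weak-type bound sees \<open>g\<close> only
    above \<open>\<tau> / \<kappa>\<close>. After Fubini the inner integral over
    \<open>\<tau>\<close> stops at \<open>\<kappa> * g y\<close>, which produces the square of
    \<open>g y\<close>.\<close>
  define \<kappa> :: real where "\<kappa> = 2 * 2 ^ DIM('a)"
  have \<kappa>: "0 < \<kappa>" by (simp add: \<kappa>_def)
  have m0: "0 \<le> m p" if "p \<in> \<B>" for p
    using that pos[of "fst p" "snd p"] V by (auto simp: m_def a_def case_prod_unfold)
  let ?vol = "\<lambda>p. emeasure lborel (ball (fst p) (snd p))"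
  have "(\<Sum>(x, R)\<in>\<B>. ennreal (1 / R ^ DIM('a)) * (\<integral>\<^sup>+ y\<in>ball x (2 * R). g y \<partial>lborel)\<^sup>2)
      = (\<Sum>p\<in>\<B>. ennreal V * (?vol p * ennreal ((m p)\<^sup>2)))"
  proof (rule sum.cong[OF refl], clarsimp)
    fix x R assume "(x, R) \<in> \<B>"
    then have R: "0 < R" using pos by auto
    have "0 \<le> a (x, R)" by (simp add: a_def)
    moreover have "1 / R ^ DIM('a) * (a (x, R))\<^sup>2 = V * (V * R ^ DIM('a) * (m (x, R))\<^sup>2)"
      using V R by (simp add: m_def power_divide power_mult_distrib field_simps power2_eq_square)
    ultimately show "ennreal (1 / R ^ DIM('a)) * (\<integral>\<^sup>+ y\<in>ball x (2 * R). g y \<partial>lborel)\<^sup>2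
        = ennreal V * (emeasure lborel (ball x R) * ennreal ((m (x, R))\<^sup>2))"
      using R V by (simp add: a ball ennreal_power flip: ennreal_mult)
  qed
  also have "\<dots> = ennreal V * (\<Sum>p\<in>\<B>. \<integral>\<^sup>+ \<tau>. ?vol p * (ennreal (2 * \<tau>) * indicator {0<..<m p} \<tau>) \<partial>lborel)"
    by (simp add: sum_distrib_left nn_integral_cmult nn_integral_layer_square m0 cong: sum.cong)
  also have "\<dots> = ennreal V * (\<integral>\<^sup>+ \<tau>. (\<Sum>p\<in>\<B>. ?vol p * (ennreal (2 * \<tau>) * indicator {0<..<m p} \<tau>)) \<partial>lborel)"
    by (subst nn_integral_sum) auto
  also have "\<dots> \<le> ennreal V * (\<integral>\<^sup>+ \<tau>. ennreal (4 * 10 ^ DIM('a)) *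
      (\<integral>\<^sup>+ y. indicator {0<..} \<tau> * (g y * indicator {y. ennreal (\<tau> / \<kappa>) < g y} y) \<partial>lborel) \<partial>lborel)"
  proof (intro mult_left_mono nn_integral_mono)
    fix \<tau> :: real
    show "(\<Sum>p\<in>\<B>. ?vol p * (ennreal (2 * \<tau>) * indicator {0<..<m p} \<tau>)) \<le> ennreal (4 * 10 ^ DIM('a)) *
      (\<integral>\<^sup>+ y. indicator {0<..} \<tau> * (g y * indicator {y. ennreal (\<tau> / \<kappa>) < g y} y) \<partial>lborel)"
    proof (cases "0 < \<tau>")
      case True
      let ?S = "{p \<in> \<B>. \<tau> < m p}"
      have "(\<Sum>p\<in>\<B>. ?vol p * (ennreal (2 * \<tau>) * indicator {0<..<m p} \<tau>))
          = (\<Sum>p\<in>?S. ?vol p * ennreal (2 * \<tau>))"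
        using True fin by (intro sum.mono_neutral_cong_right) (auto simp: indicator_def)
      also have "\<dots> = 2 * (ennreal \<tau> * (\<Sum>(x, R)\<in>?S. emeasure lborel (ball x R)))"
        using True by (simp add: ennreal_mult sum_distrib_left sum_distrib_right case_prod_unfold ac_simps)
      also have "\<dots> \<le> 2 * (ennreal (2 * 10 ^ DIM('a)) *
          (\<integral>\<^sup>+ y. g y * indicator {y. ennreal (\<tau> / \<kappa>) < g y} y \<partial>lborel))"
        unfolding \<kappa>_def
      proof (intro mult_left_mono doubled_ball_averages_weak_type)
        show "disjoint_family_on (\<lambda>(x, R). ball x R) ?S"
          using disj by (rule disjoint_family_on_mono[rotated]) auto
        fix x R assume "(x, R) \<in> ?S"
        moreover from this have R: "0 < R" using pos by auto
        ultimately have "\<tau> * (V * R ^ DIM('a)) \<le> a (x, R)"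
          using V by (simp add: m_def field_simps)
        then show "ennreal \<tau> * emeasure lborel (ball x R) \<le> (\<integral>\<^sup>+ y\<in>ball x (2 * R). g y \<partial>lborel)"
          using True V R by (simp add: a ball ennreal_leI flip: ennreal_mult)
      qed (use True fin pos in auto)
      also have "\<dots> = ennreal (4 * 10 ^ DIM('a)) *
          (\<integral>\<^sup>+ y. g y * indicator {y. ennreal (\<tau> / \<kappa>) < g y} y \<partial>lborel)"
      proof -
        have "2 * ennreal (2 * 10 ^ DIM('a)) = ennreal (2 * (2 * 10 ^ DIM('a)))"
          by (subst ennreal_mult) simp_all
        then show ?thesis by (simp add: mult.assoc[symmetric])
      qed
      finally show ?thesis
        using True by simp
    next
      case False
      then show ?thesis by (simp add: indicator_def)
    qed
  qed simp
  also have "\<dots> = ennreal V * (ennreal (4 * 10 ^ DIM('a)) * (\<integral>\<^sup>+ \<tau>.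
      (\<integral>\<^sup>+ y. indicator {0<..} \<tau> * (g y * indicator {y. ennreal (\<tau> / \<kappa>) < g y} y) \<partial>lborel) \<partial>lborel))"
    by (subst nn_integral_cmult) auto
  also have "(\<integral>\<^sup>+ \<tau>. (\<integral>\<^sup>+ y. indicator {0<..} \<tau> * (g y * indicator {y. ennreal (\<tau> / \<kappa>) < g y} y) \<partial>lborel) \<partial>lborel)
     = (\<integral>\<^sup>+ y. (\<integral>\<^sup>+ \<tau>. indicator {0<..} \<tau> * (g y * indicator {y. ennreal (\<tau> / \<kappa>) < g y} y) \<partial>lborel) \<partial>lborel)"
    by (rule lborel_pair.Fubini'[symmetric]) measurable
  also have "\<dots> \<le> (\<integral>\<^sup>+ y. ennreal \<kappa> * (g y)\<^sup>2 \<partial>lborel)"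
  proof (rule nn_integral_mono)
    fix y
    show "(\<integral>\<^sup>+ \<tau>. indicator {0<..} \<tau> * (g y * indicator {y. ennreal (\<tau> / \<kappa>) < g y} y) \<partial>lborel) \<le> ennreal \<kappa> * (g y)\<^sup>2"
    proof (cases "g y")
      case (real r)
      have "(\<integral>\<^sup>+ \<tau>. indicator {0<..} \<tau> * (g y * indicator {y. ennreal (\<tau> / \<kappa>) < g y} y) \<partial>lborel)
          \<le> (\<integral>\<^sup>+ \<tau>. g y * indicator {0..\<kappa> * r} \<tau> \<partial>lborel)"
        using \<kappa> real by (intro nn_integral_mono) (auto simp: indicator_def ennreal_less_iff field_simps)
      also have "\<dots> = ennreal \<kappa> * (g y)\<^sup>2"
        using \<kappa> real by (simp add: nn_integral_cmult_indicator power2_eq_square ac_simps ennreal_mult)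
      finally show ?thesis .
    next
      case top
      then show ?thesis using \<kappa> by (simp add: ennreal_mult_top power2_eq_square)
    qed
  qed
  also have "\<dots> = ennreal \<kappa> * (\<integral>\<^sup>+ y. (g y)\<^sup>2 \<partial>lborel)"
    by (rule nn_integral_cmult) measurable
  finally have main: "(\<Sum>(x, R)\<in>\<B>. ennreal (1 / R ^ DIM('a)) * (\<integral>\<^sup>+ y\<in>ball x (2 * R). g y \<partial>lborel)\<^sup>2) \<le>
     ennreal V * (ennreal (4 * 10 ^ DIM('a)) * (ennreal \<kappa> * (\<integral>\<^sup>+ y. (g y)\<^sup>2 \<partial>lborel)))"
    by (simp add: mult_left_mono)
  have "V * (4 * 10 ^ DIM('a) * \<kappa>) = 8 * 20 ^ DIM('a) * V"
    using power_mult_distrib[of 10 "2::real" "DIM('a)"] by (simp add: \<kappa>_def)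
  then have "ennreal V * (ennreal (4 * 10 ^ DIM('a)) * ennreal \<kappa>) = ennreal (8 * 20 ^ DIM('a) * V)"
    using V \<kappa> by (simp flip: ennreal_mult)
  then show ?thesis
    using main by (simp add: V_def mult.assoc[symmetric])
qed

section \<open>Smooth bump functions\<close>

text \<open>\<open>Ck\<close> is phrased with \<open>frechet_derivative\<close>, which is given by
  choice. Derivatives being unique, any explicit formula \<open>D\<close> may take its place in the
  inductions below.\<close>

lemma Ck_SucI:
  assumes "\<And>x. (f has_derivative D x) (at x)" "\<And>v. Ck k (\<lambda>x. D x v)"
  shows "Ck (Suc k) f"
proof -
  have "frechet_derivative f (at x) = D x" for x
    using assms(1) frechet_derivative_at by metis
  then show ?thesis
    using assms by (auto simp: differentiable_def)
qed

lemma Ck_Suc_D: "Ck (Suc k) f \<Longrightarrow> Ck k f"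
proof (induction k arbitrary: f)
  case 0
  then show ?case
    by (auto intro!: continuous_at_imp_continuous_on differentiable_imp_continuous_within)
next
  case (Suc k)
  then show ?case by (metis Ck.simps(2))
qed

lemma Ck_has_derivative:
  "Ck (Suc k) f \<Longrightarrow> (f has_derivative frechet_derivative f (at x)) (at x)"
  by (auto simp: frechet_derivative_works)

lemma Ck_const: "Ck k (\<lambda>x. c)"
proof (induction k arbitrary: c)
  case 0 show ?case by simp
next
  case (Suc k) show ?case by (rule Ck_SucI[where D="\<lambda>_ _. 0"]) (auto intro: Suc)
qed

lemma Ck_bounded_linear: "bounded_linear f \<Longrightarrow> Ck k f"
proof (induction k arbitrary: f)
  case 0 then show ?case by (simp add: linear_continuous_on)
next
  case (Suc k) show ?case
    by (rule Ck_SucI[where D="\<lambda>_. f"]) (auto intro: bounded_linear_imp_has_derivative Suc Ck_const)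
qed

lemma Ck_compose_linear: "bounded_linear l \<Longrightarrow> Ck k f \<Longrightarrow> Ck k (\<lambda>x. l (f x))"
proof (induction k arbitrary: f)
  case 0 then show ?case
    by (simp add: continuous_on_compose2 linear_continuous_on bounded_linear.continuous_on)
next
  case (Suc k)
  show ?case
  proof (rule Ck_SucI)
    show "((\<lambda>x. l (f x)) has_derivative (\<lambda>v. l (frechet_derivative f (at x) v))) (at x)" for x
      by (rule bounded_linear.has_derivative[OF Suc.prems(1) Ck_has_derivative[OF Suc.prems(2)]])
    show "Ck k (\<lambda>x. l (frechet_derivative f (at x) v))" for v
      using Suc.prems by (intro Suc.IH) auto
  qed
qed

lemma Ck_add: "Ck k f \<Longrightarrow> Ck k g \<Longrightarrow> Ck k (\<lambda>x. f x + g x)"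
proof (induction k arbitrary: f g)
  case 0 then show ?case by (simp add: continuous_on_add)
next
  case (Suc k)
  show ?case
  proof (rule Ck_SucI)
    show "((\<lambda>x. f x + g x) has_derivative
      (\<lambda>v. frechet_derivative f (at x) v + frechet_derivative g (at x) v)) (at x)" for x
      by (intro has_derivative_add Ck_has_derivative[OF Suc.prems(1)] Ck_has_derivative[OF Suc.prems(2)])
    show "Ck k (\<lambda>x. frechet_derivative f (at x) v + frechet_derivative g (at x) v)" for v
      using Suc.prems by (intro Suc.IH) auto
  qed
qed

lemma Ck_scaleR: "Ck k f \<Longrightarrow> Ck k g \<Longrightarrow> Ck k (\<lambda>x. f x *\<^sub>R g x)"
proof (induction k arbitrary: f g)
  case 0 then show ?case by (simp add: continuous_on_scaleR)
next
  case (Suc k)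
  have fg: "Ck k f" "Ck k g"
    "\<And>v. Ck k (\<lambda>x. frechet_derivative f (at x) v)"
    "\<And>v. Ck k (\<lambda>x. frechet_derivative g (at x) v)"
    using Suc.prems Ck_Suc_D by auto
  show ?case
  proof (rule Ck_SucI)
    show "((\<lambda>x. f x *\<^sub>R g x) has_derivative
      (\<lambda>v. f x *\<^sub>R frechet_derivative g (at x) v + frechet_derivative f (at x) v *\<^sub>R g x)) (at x)" for x
      by (intro has_derivative_scaleR Ck_has_derivative[OF Suc.prems(1)] Ck_has_derivative[OF Suc.prems(2)])
    show "Ck k (\<lambda>x. f x *\<^sub>R frechet_derivative g (at x) v + frechet_derivative f (at x) v *\<^sub>R g x)" for v
      by (intro Ck_add Suc.IH fg)
  qed
qed

lemma smooth_const: "smooth (\<lambda>x. c)"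
  and smooth_bounded_linear: "bounded_linear f \<Longrightarrow> smooth f"
  and smooth_compose_linear: "bounded_linear l \<Longrightarrow> smooth g \<Longrightarrow> smooth (\<lambda>x. l (g x))"
  and smooth_add: "smooth g \<Longrightarrow> smooth h \<Longrightarrow> smooth (\<lambda>x. g x + h x)"
  and smooth_scaleR: "smooth r \<Longrightarrow> smooth g \<Longrightarrow> smooth (\<lambda>x. r x *\<^sub>R g x)"
  by (simp_all add: smooth_def Ck_const Ck_bounded_linear Ck_compose_linear Ck_add Ck_scaleR)

lemma smooth_has_derivative:
  "smooth f \<Longrightarrow> (f has_derivative frechet_derivative f (at x)) (at x)"
  unfolding smooth_def by (meson Ck_has_derivative)

lemma smooth_continuous: "smooth f \<Longrightarrow> continuous_on UNIV f"
  unfolding smooth_def using Ck.simps(1) by blast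

lemma smooth_directional_derivative:
  "smooth f \<Longrightarrow> smooth (\<lambda>x. frechet_derivative f (at x) v)"
  unfolding smooth_def using Ck.simps(2) by blast

section \<open>Functions p(1/s) exp(-a/s), flat at the origin, and the radial bumps built from
  them\<close>

definition flat_exp :: "real \<Rightarrow> real poly \<Rightarrow> real \<Rightarrow> real" where
  "flat_exp a p s = (if 0 < s then poly p (1/s) * exp (- a / s) else 0)"

text \<open>The derivative of p(1/s) exp(-a/s) is (1/s^2) (a p - p')(1/s) exp(-a/s), so these
  functions form a class closed under differentiation. The polynomial as a parameter makes
  smoothness an induction; the rate \<open>a\<close> as a parameter allows exp(-1/s) to be split
  into two factors later.\<close>

definition flat_exp_deriv :: "real \<Rightarrow> real poly \<Rightarrow> real poly" where
  "flat_exp_deriv a p = monom 1 2 * (smult a p - pderiv p)"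

lemma poly_times_exp_tendsto_0:
  fixes p :: "real poly"
  assumes "0 < a"
  shows "((\<lambda>x. poly p x * exp (- a * x)) \<longlongrightarrow> 0) at_top"
proof -
  have mono: "((\<lambda>x. x ^ n * exp (- a * x)) \<longlongrightarrow> 0) at_top" for n :: nat
  proof -
    have "((\<lambda>x. (a * x) ^ n / exp (a * x)) \<longlongrightarrow> 0) at_top"
      by (rule filterlim_compose[OF tendsto_power_div_exp_0])
        (rule filterlim_tendsto_pos_mult_at_top[OF tendsto_const assms filterlim_ident])
    then have "((\<lambda>x. (a * x) ^ n / exp (a * x) / a ^ n) \<longlongrightarrow> 0 / a ^ n) at_top"
      by (intro tendsto_intros) (use assms in auto)
    then show ?thesis
      using assms by (simp add: power_mult_distrib exp_minus field_simps)
  qed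
  have "((\<lambda>x. \<Sum>i\<le>degree p. coeff p i * (x ^ i * exp (- a * x))) \<longlongrightarrow> (\<Sum>i\<le>degree p. coeff p i * 0)) at_top"
    by (intro tendsto_intros mono)
  then show ?thesis
    by (simp add: poly_altdef sum_distrib_right mult.assoc)
qed

lemma flat_exp_has_derivative:
  assumes "0 < a"
  shows "(flat_exp a p has_real_derivative flat_exp a (flat_exp_deriv a p) s) (at s)"
proof -
  consider "0 < s" | "s < 0" | "s = 0" by linarith
  then show ?thesis
  proof cases
    case 1
    have inv: "((\<lambda>s. 1 / s) has_real_derivative - (1 / s\<^sup>2)) (at s)"
      using DERIV_inverse[of s] 1 by (simp add: inverse_eq_divide power2_eq_square)
    have "((\<lambda>s. - a * (1 / s)) has_real_derivative - a * - (1 / s\<^sup>2)) (at s)"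
      by (rule DERIV_cmult[OF inv])
    from DERIV_mult'[OF DERIV_chain2[OF poly_DERIV inv] DERIV_chain2[OF DERIV_exp this]]
    have "((\<lambda>s. poly p (1/s) * exp (- a / s)) has_real_derivative
        poly (pderiv p) (1/s) * (- (1 / s\<^sup>2)) * exp (- a / s)
        + poly p (1/s) * (exp (- a / s) * (a / s\<^sup>2))) (at s)"
      by (simp add: algebra_simps)
    moreover have "poly (pderiv p) (1/s) * (- (1 / s\<^sup>2)) * exp (- a / s)
        + poly p (1/s) * (exp (- a / s) * (a / s\<^sup>2)) = flat_exp a (flat_exp_deriv a p) s"
      using 1 by (simp add: flat_exp_def flat_exp_deriv_def poly_monom power_one_over field_simps)
    ultimately have "((\<lambda>s. poly p (1/s) * exp (- a / s)) has_real_derivative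
        flat_exp a (flat_exp_deriv a p) s) (at s)" by simp
    then show ?thesis
      by (rule has_field_derivative_transform_within_open[where S="{0<..}"])
        (use 1 in \<open>auto simp: flat_exp_def\<close>)
  next
    case 2
    have "((\<lambda>_. 0) has_real_derivative flat_exp a (flat_exp_deriv a p) s) (at s)"
      using 2 by (simp add: flat_exp_def)
    then show ?thesis
      by (rule has_field_derivative_transform_within_open[where S="{..<0}"])
        (use 2 in \<open>auto simp: flat_exp_def\<close>)
  next
    case 3
    \<comment> \<open>At the origin the difference quotient is treated directly: it vanishes on the
      left, and with x = 1/h it is x p(x) exp(-a x) on the right.\<close>
    have "((\<lambda>h. flat_exp a p h / h) \<longlongrightarrow> 0) (at 0)"
      unfolding filterlim_at_split
    proof
      have "((\<lambda>h. flat_exp a p h / h) \<longlongrightarrow> 0) (at_left 0) \<longleftrightarrow> ((\<lambda>h. 0::real) \<longlongrightarrow> 0) (at_left (0::real))"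
        by (intro filterlim_cong refl eventually_at_leftI[of "-1"]) (auto simp: flat_exp_def)
      then show "((\<lambda>h. flat_exp a p h / h) \<longlongrightarrow> 0) (at_left 0)" by simp
      have "((\<lambda>h. poly (monom 1 1 * p) (inverse h) * exp (- a * inverse h)) \<longlongrightarrow> 0) (at_right 0)"
        by (rule filterlim_compose[OF poly_times_exp_tendsto_0[OF assms] filterlim_inverse_at_top_right])
      moreover have "((\<lambda>h. flat_exp a p h / h) \<longlongrightarrow> 0) (at_right 0) \<longleftrightarrow>
        ((\<lambda>h. poly (monom 1 1 * p) (inverse h) * exp (- a * inverse h)) \<longlongrightarrow> 0) (at_right 0)"
        by (intro filterlim_cong refl eventually_at_rightI[of _ 1])
          (auto simp: flat_exp_def poly_monom field_simps)
      ultimately show "((\<lambda>h. flat_exp a p h / h) \<longlongrightarrow> 0) (at_right 0)" by simp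
    qed
    then show ?thesis
      unfolding 3 DERIV_def by (simp add: flat_exp_def)
  qed
qed

lemma flat_exp_continuous: "0 < a \<Longrightarrow> continuous_on UNIV (flat_exp a p)"
  by (rule DERIV_continuous_on) (rule flat_exp_has_derivative)

text \<open>The squared norm keeps the argument smooth at the centre. For R > 0 it is positive
  exactly on the open ball of radius 2 R and at least 3 on the ball of radius R; hence the bump
  vanishes off the doubled ball and is at least exp(-1/3) on the ball.\<close>

definition bump_arg :: "'a::euclidean_space \<Rightarrow> real \<Rightarrow> 'a \<Rightarrow> real" where
  "bump_arg x0 R x = 4 - (norm (x - x0))\<^sup>2 / R\<^sup>2"

lemma bump_has_derivative:
  assumes "0 < a"
  shows "((\<lambda>x. flat_exp a p (bump_arg x0 R x)) has_derivative
     (\<lambda>v. flat_exp a (flat_exp_deriv a p) (bump_arg x0 R x) * (-2 / R\<^sup>2 * ((x - x0) \<bullet> v)))) (at x)"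
proof -
  have "(bump_arg x0 R has_derivative (\<lambda>v. -2 / R\<^sup>2 * ((x - x0) \<bullet> v))) (at x)"
    unfolding bump_arg_def[abs_def] power2_norm_eq_inner divide_inverse
    by (auto intro!: derivative_eq_intros simp: inner_commute)
  from has_derivative_compose[OF this flat_exp_has_derivative[OF assms, unfolded has_field_derivative_def]]
  show ?thesis by simp
qed

text \<open>The polynomial stays arbitrary in the induction: a directional derivative is a function
  of the same kind, with another polynomial, times an affine function of the point.\<close>

lemma Ck_bump:
  assumes "0 < a"
  shows "Ck k (\<lambda>x. flat_exp a p (bump_arg x0 R x))"
proof (induction k arbitrary: p)
  case 0
  have "continuous_on UNIV (bump_arg x0 R)"
    unfolding bump_arg_def[abs_def] divide_inverse by (intro continuous_intros)
  then show ?case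
    using continuous_on_compose2[OF flat_exp_continuous[OF assms]] by simp
next
  case (Suc k)
  have "Ck k (\<lambda>x. -2 / R\<^sup>2 * ((x - x0) \<bullet> v))" for v
  proof -
    have "Ck k (\<lambda>x. -2 / R\<^sup>2 * (x \<bullet> v) + 2 / R\<^sup>2 * (x0 \<bullet> v))"
      by (intro Ck_add Ck_const Ck_bounded_linear bounded_linear_const_mult bounded_linear_inner_left)
    then show ?thesis by (simp add: inner_diff_left algebra_simps diff_divide_distrib)
  qed
  from Ck_scaleR[OF Suc this] show ?case
    by (intro Ck_SucI[OF bump_has_derivative[OF assms]]) (simp only: real_scaleR_def)
qed

lemma smooth_bump: "0 < a \<Longrightarrow> smooth (\<lambda>x. flat_exp a p (bump_arg x0 R x))"
  by (simp add: smooth_def Ck_bump)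

lemma bump_eq_0: "0 < R \<Longrightarrow> x \<notin> ball x0 (2 * R) \<Longrightarrow> flat_exp a p (bump_arg x0 R x) = 0"
proof -
  assume "0 < R" "x \<notin> ball x0 (2 * R)"
  then have "(2 * R)\<^sup>2 \<le> (norm (x - x0))\<^sup>2"
    by (intro power_mono) (auto simp: dist_norm norm_minus_commute)
  then show ?thesis
    using \<open>0 < R\<close> by (simp add: flat_exp_def bump_arg_def field_simps)
qed

lemma test_function_bump:
  assumes "0 < R" "0 < a" "smooth g"
  shows "test_function (\<lambda>x. flat_exp a p (bump_arg x0 R x) *\<^sub>R g x)"
  unfolding test_function_def
proof
  show "smooth (\<lambda>x. flat_exp a p (bump_arg x0 R x) *\<^sub>R g x)"
    by (intro smooth_scaleR smooth_bump assms)
  have "support_of (\<lambda>x. flat_exp a p (bump_arg x0 R x) *\<^sub>R g x) \<subseteq> cball x0 (2 * R)"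
    unfolding support_of_def
    by (rule closure_minimal) (use bump_eq_0[OF assms(1)] ball_subset_cball in fastforce)+
  then show "compact (support_of (\<lambda>x. flat_exp a p (bump_arg x0 R x) *\<^sub>R g x))"
    unfolding support_of_def
    by (meson bounded_cball bounded_subset closed_closure compact_eq_bounded_closed)
qed

section \<open>Fourier decay of test functions\<close>

lemma compact_support_of:
  fixes f :: "'a::t2_space \<Rightarrow> 'b::zero"
  assumes "compact K" "{x. f x \<noteq> 0} \<subseteq> K"
  shows "compact (support_of f)"
proof -
  have "support_of f \<subseteq> K"
    unfolding support_of_def using assms by (intro closure_minimal compact_imp_closed)
  moreover have "closed (support_of f)" by (simp add: support_of_def)
  ultimately show ?thesis
    using compact_Int_closed[OF assms(1)] by (metis Int_absorb1)
qed

lemma support_of_eq_0: "x \<notin> support_of f \<Longrightarrow> f x = 0"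
  unfolding support_of_def using closure_subset[of "{x. f x \<noteq> 0}"] by auto

lemma test_function_directional_derivative:
  assumes "test_function f"
  shows "test_function (\<lambda>x. frechet_derivative f (at x) v)"
proof -
  have "frechet_derivative f (at x) v = 0" if "x \<notin> support_of f" for x
  proof -
    have "open (- support_of f)" by (simp add: support_of_def open_Compl)
    then have "(f has_derivative (\<lambda>_. 0)) (at x)"
      by (rule has_derivative_transform_within_open[of "\<lambda>_. 0", rotated])
        (use that support_of_eq_0[of _ f] in auto)
    then show ?thesis by (metis frechet_derivative_at)
  qed
  then have "{x. frechet_derivative f (at x) v \<noteq> 0} \<subseteq> support_of f" by blast
  moreover have "smooth f" "compact (support_of f)" using assms by (simp_all add: test_function_def)
  ultimately show ?thesis
    using smooth_directional_derivative[of f v] compact_support_of[of "support_of f"]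
    by (simp add: test_function_def)
qed

lemma test_function_compose_linear:
  assumes "bounded_linear l" "test_function f"
  shows "test_function (\<lambda>x. l (f x))"
proof -
  have "{x. l (f x) \<noteq> 0} \<subseteq> support_of f"
    using support_of_eq_0[of _ f] linear_0[OF bounded_linear.linear[OF assms(1)]] by force
  moreover have "smooth f" "compact (support_of f)" using assms by (simp_all add: test_function_def)
  ultimately show ?thesis
    using smooth_compose_linear[OF assms(1), of f] compact_support_of[of "support_of f"]
    by (simp add: test_function_def)
qed

lemma test_function_continuous: "test_function f \<Longrightarrow> continuous_on UNIV f"
  by (simp add: test_function_def smooth_continuous)

lemma test_function_borel:
  fixes f :: "'a::euclidean_space \<Rightarrow> 'b::real_normed_vector"
  shows "test_function f \<Longrightarrow> f \<in> borel_measurable borel"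
  by (simp add: borel_measurable_continuous_onI test_function_continuous)

lemma test_function_bounds:
  assumes "test_function f"
  obtains r M where "0 < r" "\<And>x. r < norm x \<Longrightarrow> f x = 0" "0 < M" "\<And>x. norm (f x) \<le> M"
proof -
  have c: "compact (support_of f)" using assms by (simp add: test_function_def)
  then obtain r where r: "0 < r" "\<And>x. x \<in> support_of f \<Longrightarrow> norm x \<le> r"
    by (meson bounded_pos compact_imp_bounded)
  have "compact (f ` support_of f)"
    by (intro compact_continuous_image c continuous_on_subset[OF test_function_continuous[OF assms]]) simp
  then obtain M where M: "0 < M" "\<And>y. y \<in> f ` support_of f \<Longrightarrow> norm y \<le> M"
    by (meson bounded_pos compact_imp_bounded)
  show thesis
  proof
    show "f x = 0" if "r < norm x" for x
      using r(2)[of x] that support_of_eq_0[of x f] by fastforce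
    show "norm (f x) \<le> M" for x
      using M support_of_eq_0[of x f] by (cases "x \<in> support_of f") auto
  qed fact+
qed

lemma integrable_bounded_support:
  fixes f :: "'a::euclidean_space \<Rightarrow> 'b::{banach, second_countable_topology}"
  assumes "f \<in> borel_measurable lborel" "\<And>x. r < norm x \<Longrightarrow> f x = 0" "\<And>x. norm (f x) \<le> M"
  shows "integrable lborel f"
proof (rule Bochner_Integration.integrable_bound)
  show "integrable lborel (\<lambda>x::'a. M * indicat_real (cball 0 r) x)"
    using emeasure_lborel_cball_finite[of "0::'a" r] by (intro integrable_mult_right integrable_real_indicator) auto
  show "AE x in lborel. norm (f x) \<le> norm (M * indicat_real (cball 0 r) x)"
    using assms(2,3) by (auto simp: indicator_def not_le intro!: AE_I2)
      (meson assms(3) abs_ge_self order_trans)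
qed fact

section \<open>Translations, derivatives and decay under the Fourier transform\<close>

lemma lborel_integral_translate:
  fixes g :: "'a::euclidean_space \<Rightarrow> 'b::{banach, second_countable_topology}"
  assumes [measurable]: "g \<in> borel_measurable borel"
  shows "(LINT x|lborel. g (c + x)) = (LINT x|lborel. g x)"
proof -
  have "(LINT x|lborel. g x) = (LINT x|distr lborel borel ((+) c). g x)"
    by (simp add: lborel_distr_plus)
  also have "\<dots> = (LINT x|lborel. g (c + x))"
    by (rule integral_distr) measurable
  finally show ?thesis ..
qed

lemma fourier_lborel:
  assumes [measurable]: "g \<in> borel_measurable borel"
  shows "fourier g \<eta> = (LINT x|lborel. of_real (g x) * cis (- (x \<bullet> \<eta>)))"
  unfolding fourier_def
  by (rule integral_completion) (simp add: cis_conv_exp)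

lemma fourier_translate:
  assumes [measurable]: "g \<in> borel_measurable borel"
  shows "fourier (\<lambda>x. g (c + x)) \<eta> = cis (c \<bullet> \<eta>) * fourier g \<eta>"
proof -
  have "fourier (\<lambda>x. g (c + x)) \<eta> = (LINT x|lborel. cis (c \<bullet> \<eta>) * (of_real (g (c + x)) * cis (- ((c + x) \<bullet> \<eta>))))"
    by (subst fourier_lborel, measurable, rule Bochner_Integration.integral_cong) (simp_all add: cis_mult inner_add_left mult.left_commute)
  also have "\<dots> = cis (c \<bullet> \<eta>) * (LINT x|lborel. of_real (g (c + x)) * cis (- ((c + x) \<bullet> \<eta>)))"
    by simp
  also have "(LINT x|lborel. of_real (g (c + x)) * cis (- ((c + x) \<bullet> \<eta>))) = fourier g \<eta>"
    by (subst lborel_integral_translate) (simp_all add: fourier_lborel cis_conv_exp)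
  finally show ?thesis .
qed

text \<open>Instead of integrating by parts, translation invariance is applied to the difference quotients of \<open>f\<close>.\<close>

lemma fourier_directional_derivative:
  fixes f :: "real^3 \<Rightarrow> real"
  assumes f: "test_function f"
  shows "fourier (\<lambda>x. frechet_derivative f (at x) v) \<eta> = \<i> * of_real (v \<bullet> \<eta>) * fourier f \<eta>"
proof -
  let ?D = "\<lambda>x. frechet_derivative f (at x) v"
  \<comment> \<open>Steps in (0, 1] tending to 0: the bound by 1 keeps all translates of the support
    in one ball of radius \<open>r + norm v\<close>, which carries the dominating function.\<close>
  define h where "h n = inverse (real (Suc n))" for n
  define q where "q n x = (f (h n *\<^sub>R v + x) - f x) / h n" for n x
  have h: "0 < h n" "h n \<le> 1" for n by (auto simp: h_def field_simps)
  have hne: "h n \<noteq> 0" for n using h(1)[of n] by simp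
  have hlim: "h \<longlonglongrightarrow> 0" unfolding h_def by (rule LIMSEQ_inverse_real_of_nat)
  have [measurable]: "f \<in> borel_measurable borel" "?D \<in> borel_measurable borel"
    using f test_function_borel test_function_directional_derivative by blast+
  obtain r M where r: "0 < r" "\<And>x. r < norm x \<Longrightarrow> f x = 0" and M: "0 < M" "\<And>x. norm (f x) \<le> M"
    using test_function_bounds[OF f] by metis
  obtain r' M' where M': "0 < M'" "\<And>x. norm (?D x) \<le> M'"
    using test_function_bounds[OF test_function_directional_derivative[OF f, of v]] by metis
  have deriv: "((\<lambda>t. f (t *\<^sub>R v + x)) has_real_derivative ?D (t *\<^sub>R v + x)) (at t)" for t x
  proof -
    have D: "(f has_derivative frechet_derivative f (at (t *\<^sub>R v + x))) (at (t *\<^sub>R v + x))"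
      using f smooth_has_derivative by (auto simp: test_function_def)
    have "((\<lambda>t. t *\<^sub>R v + x) has_derivative (\<lambda>s. s *\<^sub>R v)) (at t)"
      by (auto intro!: derivative_eq_intros)
    from has_derivative_compose[OF this D]
    have "((\<lambda>t. f (t *\<^sub>R v + x)) has_derivative (\<lambda>s. s * ?D (t *\<^sub>R v + x))) (at t)"
      using linear_scale[OF has_derivative_linear[OF D]] by simp
    moreover have "(\<lambda>s. s * ?D (t *\<^sub>R v + x)) = (*) (?D (t *\<^sub>R v + x))" by (auto simp: mult.commute)
    ultimately show ?thesis by (simp add: has_field_derivative_def)
  qed
  have integ: "integrable lborel (\<lambda>x. of_real (f (c + x)) * cis (- (x \<bullet> \<eta>)))" for c
  proof (rule integrable_bounded_support)
    show "complex_of_real (f (c + x)) * cis (- (x \<bullet> \<eta>)) = 0" if "r + norm c < norm x" for x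
    proof -
      have "r < norm (c + x)" using that norm_triangle_ineq[of "c + x" "-c"] by simp
      then show ?thesis using r by simp
    qed
  qed (use M in \<open>auto simp: norm_mult cis_conv_exp\<close>)
  have quotient: "(LINT x|lborel. of_real (q n x) * cis (- (x \<bullet> \<eta>))) =
      (cis (h n * (v \<bullet> \<eta>)) - 1) / of_real (h n) * fourier f \<eta>" for n
  proof -
    have "(LINT x|lborel. of_real (q n x) * cis (- (x \<bullet> \<eta>))) =
       (LINT x|lborel. (of_real (f (h n *\<^sub>R v + x)) * cis (- (x \<bullet> \<eta>)) - of_real (f (0 + x)) * cis (- (x \<bullet> \<eta>))) / of_real (h n))"
      by (rule Bochner_Integration.integral_cong) (auto simp: q_def field_simps)
    also have "\<dots> = (fourier (\<lambda>x. f (h n *\<^sub>R v + x)) \<eta> - fourier f \<eta>) / of_real (h n)"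
      using integ[of "h n *\<^sub>R v"] integ[of 0]
      by (simp add: fourier_lborel Bochner_Integration.integral_diff)
    also have "\<dots> = (cis (h n * (v \<bullet> \<eta>)) - 1) / of_real (h n) * fourier f \<eta>"
      by (subst fourier_translate) (auto simp: field_simps)
    finally show ?thesis .
  qed
  have "(\<lambda>n. LINT x|lborel. of_real (q n x) * cis (- (x \<bullet> \<eta>))) \<longlonglongrightarrow> (LINT x|lborel. of_real (?D x) * cis (- (x \<bullet> \<eta>)))"
  proof (rule integral_dominated_convergence)
    show "integrable lborel (\<lambda>x::real^3. M' * indicat_real (cball 0 (r + norm v)) x)"
      using emeasure_lborel_cball_finite[of "0::real^3" "r + norm v"]
      by (intro integrable_mult_right integrable_real_indicator) auto
    show "AE x in lborel. (\<lambda>n. complex_of_real (q n x) * cis (- (x \<bullet> \<eta>))) \<longlonglongrightarrow> of_real (?D x) * cis (- (x \<bullet> \<eta>))"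
    proof (intro AE_I2 tendsto_intros)
      fix x
      have "((\<lambda>s. (f (s *\<^sub>R v + x) - f x) / s) \<longlongrightarrow> ?D x) (at 0)"
        using deriv[of x 0] by (simp add: DERIV_def)
      moreover have "filterlim h (at 0) sequentially"
        using hlim hne by (simp add: filterlim_at)
      ultimately show "(\<lambda>n. q n x) \<longlonglongrightarrow> ?D x"
        unfolding q_def by (rule filterlim_compose)
    qed
    show "AE x in lborel. norm (complex_of_real (q n x) * cis (- (x \<bullet> \<eta>))) \<le> M' * indicat_real (cball 0 (r + norm v)) x" for n
    proof (rule AE_I2)
      fix x
      have "\<bar>q n x\<bar> \<le> M'"
      proof -
        obtain z where "f (h n *\<^sub>R v + x) - f (0 *\<^sub>R v + x) = (h n - 0) * ?D (z *\<^sub>R v + x)"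
          using MVT2[of 0 "h n" "\<lambda>t. f (t *\<^sub>R v + x)" "\<lambda>t. ?D (t *\<^sub>R v + x)"] h(1) deriv by blast
        then have "q n x = ?D (z *\<^sub>R v + x)" using h(1)[of n] by (simp add: q_def)
        then show ?thesis using M' by simp
      qed
      moreover have "q n x = 0" if "r + norm v < norm x"
      proof -
        have "norm (h n *\<^sub>R v) \<le> norm v" using h[of n] by (simp add: mult_left_le_one_le)
        then have "r < norm (h n *\<^sub>R v + x)"
          using that norm_triangle_ineq[of "h n *\<^sub>R v + x" "- (h n *\<^sub>R v)"] by simp
        moreover have "r < norm x" using that norm_ge_zero[of v] by linarith
        ultimately show ?thesis using r by (simp add: q_def)
      qed
      ultimately show "norm (complex_of_real (q n x) * cis (- (x \<bullet> \<eta>))) \<le> M' * indicat_real (cball 0 (r + norm v)) x"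
        by (auto simp: norm_mult indicator_def not_le)
    qed
  qed (simp_all add: q_def cis_conv_exp)
  moreover have "(\<lambda>n. (cis (h n * (v \<bullet> \<eta>)) - 1) / of_real (h n) * fourier f \<eta>) \<longlonglongrightarrow> \<i> * of_real (v \<bullet> \<eta>) * fourier f \<eta>"
  proof (rule tendsto_mult_right)
    let ?w = "\<i> * complex_of_real (v \<bullet> \<eta>)"
    have "((\<lambda>z. exp (?w * z)) has_field_derivative ?w) (at 0)"
      by (auto intro!: derivative_eq_intros)
    then have "((\<lambda>z. (exp (?w * z) - 1) / z) \<longlongrightarrow> ?w) (at 0)"
      by (simp add: DERIV_def)
    moreover have "filterlim (\<lambda>n. complex_of_real (h n)) (at 0) sequentially"
      using tendsto_of_real[OF hlim, where 'a=complex] hne by (simp add: filterlim_at)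
    ultimately have "(\<lambda>n. (exp (?w * of_real (h n)) - 1) / of_real (h n)) \<longlonglongrightarrow> ?w"
      by (rule filterlim_compose)
    then show "(\<lambda>n. (cis (h n * (v \<bullet> \<eta>)) - 1) / of_real (h n)) \<longlonglongrightarrow> ?w"
      by (simp add: cis_conv_exp ac_simps)
  qed
  ultimately have "(LINT x|lborel. of_real (?D x) * cis (- (x \<bullet> \<eta>))) = \<i> * of_real (v \<bullet> \<eta>) * fourier f \<eta>"
    unfolding quotient by (rule LIMSEQ_unique)
  then show ?thesis by (simp add: fourier_lborel)
qed

text \<open>A factor \<eta>_i is exchanged for a derivative in direction i, so power n + 1 for
  \<open>f\<close> is power n for that derivative. For n = 0 the L^1 norm bounds the
  transform.\<close>

lemma fourier_coordinate_decay:
  fixes f :: "real^3 \<Rightarrow> real"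
  assumes "test_function f"
  shows "\<exists>C. \<forall>\<eta>. \<bar>\<eta> $ i\<bar> ^ n * cmod (fourier f \<eta>) \<le> C"
  using assms
proof (induction n arbitrary: f)
  case 0
  have "cmod (fourier f \<eta>) \<le> (LINT x|lborel. \<bar>f x\<bar>)" for \<eta>
    using integral_norm_bound[of lborel "\<lambda>x. of_real (f x) * cis (- (x \<bullet> \<eta>))"]
    by (simp add: fourier_lborel test_function_borel[OF 0] norm_mult)
  then show ?case by auto
next
  case (Suc n)
  from Suc.IH[OF test_function_directional_derivative[OF Suc.prems, of "axis i 1"]]
  show ?case
    by (simp only: fourier_directional_derivative[OF Suc.prems] norm_mult norm_ii norm_of_real inner_axis'
        mult_1_left real_scaleR_def inner_real_def mult.assoc mult.left_commute power_Suc)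
qed

lemma fourier_decay:
  fixes f :: "real^3 \<Rightarrow> real"
  assumes "test_function f"
  obtains C where "0 < C" "\<And>\<eta>. (1 + (norm \<eta>)\<^sup>2) ^ m * cmod (fourier f \<eta>) \<le> C"
proof -
  have "\<exists>C. \<forall>\<eta>. \<bar>\<eta> $ i\<bar> ^ (2 * m) * cmod (fourier f \<eta>) \<le> C" for i
    by (rule fourier_coordinate_decay[OF assms])
  then obtain C where C: "\<And>i \<eta>. \<bar>\<eta> $ i\<bar> ^ (2 * m) * cmod (fourier f \<eta>) \<le> C i" by metis
  obtain C0 where C0: "\<And>\<eta>. cmod (fourier f \<eta>) \<le> C0"
    using fourier_coordinate_decay[OF assms, of _ 0] by (metis mult_1 power_0)
  define B where "B = 4 ^ m * (\<bar>C0\<bar> + (\<Sum>i\<in>UNIV. \<bar>C i\<bar>)) + 1"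
  have "(1 + (norm \<eta>)\<^sup>2) ^ m * cmod (fourier f \<eta>) \<le> B" for \<eta>
  proof -
    \<comment> \<open>The largest of 1 and the squared coordinates: 1 + |\<eta>|^2 is at most 4 t,
      and t^m is either 1 or an even power of a single coordinate, so no expansion of the power is
      needed.\<close>
    define t where "t = Max (insert 1 (range (\<lambda>i. \<bar>\<eta> $ i\<bar>\<^sup>2)))"
    have t: "1 \<le> t" "\<And>i. \<bar>\<eta> $ i\<bar>\<^sup>2 \<le> t" unfolding t_def by (rule Max_ge; simp)+
    have "t \<in> insert 1 (range (\<lambda>i. \<bar>\<eta> $ i\<bar>\<^sup>2))" unfolding t_def by (rule Max_in) auto
    then have tm: "t ^ m * cmod (fourier f \<eta>) \<le> \<bar>C0\<bar> + (\<Sum>i\<in>UNIV. \<bar>C i\<bar>)"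
    proof
      assume "t = 1"
      then have "t ^ m * cmod (fourier f \<eta>) \<le> \<bar>C0\<bar>" using C0[of \<eta>] by simp
      then show ?thesis by (rule add_increasing2[rotated]) (simp add: sum_nonneg)
    next
      assume "t \<in> range (\<lambda>i. \<bar>\<eta> $ i\<bar>\<^sup>2)"
      then obtain i where "t = \<bar>\<eta> $ i\<bar>\<^sup>2" by auto
      then have "t ^ m = \<bar>\<eta> $ i\<bar> ^ (2 * m)" by (simp only: power_mult)
      then have "t ^ m * cmod (fourier f \<eta>) \<le> \<bar>C i\<bar>" 
        using order_trans[OF C[of \<eta> i] abs_ge_self] by simp
      also have "\<bar>C i\<bar> \<le> (\<Sum>i\<in>UNIV. \<bar>C i\<bar>)" by (rule member_le_sum) auto
      finally show ?thesis by simp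
    qed
    have "(norm \<eta>)\<^sup>2 = (\<Sum>i\<in>UNIV. \<bar>\<eta> $ i\<bar>\<^sup>2)"
      unfolding power2_norm_eq_inner by (simp add: inner_vec_def power2_eq_square)
    also have "\<dots> \<le> 3 * t"
      using sum_mono[of "UNIV :: 3 set" "\<lambda>i. \<bar>\<eta> $ i\<bar>\<^sup>2" "\<lambda>_. t"] t by simp
    finally have "(1 + (norm \<eta>)\<^sup>2) ^ m \<le> (4 * t) ^ m"
      using t by (intro power_mono) auto
    then have "(1 + (norm \<eta>)\<^sup>2) ^ m * cmod (fourier f \<eta>) \<le> (4 * t) ^ m * cmod (fourier f \<eta>)"
      by (rule mult_right_mono) simp
    also have "\<dots> \<le> 4 ^ m * (\<bar>C0\<bar> + (\<Sum>i\<in>UNIV. \<bar>C i\<bar>))"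
      using tm by (simp add: power_mult_distrib mult.assoc)
    finally show ?thesis by (simp add: B_def)
  qed
  moreover have "0 < B" by (auto simp: B_def intro!: add_nonneg_pos mult_nonneg_nonneg add_nonneg_nonneg sum_nonneg)
  ultimately show thesis using that by blast
qed

text \<open>Comparison with a series over the integer part n of |\<eta>|, in place of polar
  coordinates: the integrand is at most 1 / (1 + n^2)^3 there, on a ball of volume of order (n +
  1)^3, which leaves terms of order (n + 1)^(-3).\<close>

lemma nn_integral_japanese_bracket_finite:
  "(\<integral>\<^sup>+ \<eta>. ennreal (1 / (1 + (norm (\<eta> :: real^3))\<^sup>2) ^ 3) \<partial>lborel) < \<infinity>"
proof -
  define c where "c n = 1 / (1 + (real n)\<^sup>2) ^ 3" for n
  define V where "V = unit_ball_vol 3"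
  have "ennreal (1 / (1 + (norm \<eta>)\<^sup>2) ^ 3) \<le> (\<Sum>n. ennreal (c n) * indicator (ball 0 (real n + 1)) \<eta>)" for \<eta> :: "real^3"
  proof -
    define n where "n = nat \<lfloor>norm \<eta>\<rfloor>"
    have n: "real n \<le> norm \<eta>" "norm \<eta> < real n + 1" by (auto simp: n_def)
    have "(real n)\<^sup>2 \<le> (norm \<eta>)\<^sup>2" using n by (intro power_mono) auto
    then have "1 / (1 + (norm \<eta>)\<^sup>2) ^ 3 \<le> c n"
      unfolding c_def by (intro divide_left_mono power_mono mult_pos_pos zero_less_power) (auto intro: add_pos_nonneg)
    then have "ennreal (1 / (1 + (norm \<eta>)\<^sup>2) ^ 3) \<le> ennreal (c n) * indicator (ball 0 (real n + 1)) \<eta>"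
      using n by (simp add: ennreal_leI)
    also have "\<dots> = (\<Sum>k\<in>{n}. ennreal (c k) * indicator (ball 0 (real k + 1)) \<eta>)"
      by (subst sum.insert) simp_all
    also have "\<dots> \<le> (\<Sum>n. ennreal (c n) * indicator (ball 0 (real n + 1)) \<eta>)"
      by (intro sum_le_suminf) auto
    finally show ?thesis .
  qed
  then have "(\<integral>\<^sup>+ \<eta>. ennreal (1 / (1 + (norm (\<eta> :: real^3))\<^sup>2) ^ 3) \<partial>lborel)
      \<le> (\<integral>\<^sup>+ \<eta>. (\<Sum>n. ennreal (c n) * indicator (ball (0 :: real^3) (real n + 1)) \<eta>) \<partial>lborel)"
    by (rule nn_integral_mono)
  also have "\<dots> = (\<Sum>n. ennreal (c n) * emeasure lborel (ball (0 :: real^3) (real n + 1)))"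
    by (subst nn_integral_suminf) (auto simp: nn_integral_cmult_indicator)
  also have "\<dots> \<le> (\<Sum>n. ennreal (8 * V * inverse (real (Suc n) ^ 3)))"
  proof (intro suminf_le)
    fix n
    let ?N = "real n + 1"
    have "?N\<^sup>2 \<le> 2 * (1 + (real n)\<^sup>2)"
      using sum_squares_ge_zero[of "real n - 1" 0] by (simp add: power2_eq_square algebra_simps)
    then have "(?N\<^sup>2) ^ 3 \<le> (2 * (1 + (real n)\<^sup>2)) ^ 3" by (intro power_mono) auto
    then have "?N ^ 3 * ?N ^ 3 \<le> 8 * (1 + (real n)\<^sup>2) ^ 3"
      by (simp only: power_mult_distrib) (simp add: power_mult[symmetric] power_add[symmetric])
    moreover have "0 < (1 + (real n)\<^sup>2) ^ 3" by (intro zero_less_power add_pos_nonneg) auto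
    ultimately have "c n * ?N ^ 3 \<le> 8 * inverse (?N ^ 3)"
      by (simp add: c_def field_simps)
    then have "V * (c n * ?N ^ 3) \<le> V * (8 * inverse (?N ^ 3))"
      by (rule mult_left_mono) (simp add: V_def)
    moreover have "emeasure lborel (ball (0 :: real^3) (real n + 1)) = ennreal (V * ?N ^ 3)"
      by (subst emeasure_ball) (simp_all add: V_def power3_eq_cube)
    ultimately show "ennreal (c n) * emeasure lborel (ball (0 :: real^3) (real n + 1)) \<le> ennreal (8 * V * inverse (real (Suc n) ^ 3))"
      by (simp add: V_def c_def ennreal_leI mult.left_commute mult.assoc add.commute flip: ennreal_mult)
  qed auto
  also have "\<dots> = ennreal (\<Sum>n. 8 * V * inverse (real (Suc n) ^ 3))"
  proof (rule suminf_ennreal2)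
    show "summable (\<lambda>n. 8 * V * inverse (real (Suc n) ^ 3))"
      using inverse_power_summable[of 3, where 'a=real] summable_Suc_iff[of "\<lambda>n. inverse (real n ^ 3)"]
      by (intro summable_mult) (simp del: of_nat_Suc)
  qed (simp add: V_def)
  finally show ?thesis by (simp add: le_less_trans)
qed

proposition H_norm_sq_finite:
  assumes "test_function \<phi>"
  shows "H_norm_sq L \<phi> < \<infinity>"
proof -
  \<comment> \<open>The ceiling absorbs the weight of exponent \<open>L\<close>, and the extra 3
    leaves the integrable factor (1 + |\<eta>|^2)^(-3).\<close>
  define m where "m = nat \<lceil>\<bar>L\<bar>\<rceil> + 3"
  have "\<exists>C>0. \<forall>\<eta>. (1 + (norm \<eta>)\<^sup>2) ^ m * cmod (fourier (\<lambda>x. \<phi> x $ i) \<eta>) \<le> C" for i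
    using fourier_decay[OF test_function_compose_linear[OF bounded_linear_vec_nth assms]] by metis
  then obtain C where C: "\<And>i. 0 < C i"
    "\<And>i \<eta>. (1 + (norm \<eta>)\<^sup>2) ^ m * cmod (fourier (\<lambda>x. \<phi> x $ i) \<eta>) \<le> C i" by metis
  have "(1 + (norm \<eta>)\<^sup>2) powr L * (\<Sum>i\<in>UNIV. (cmod (fourier (\<lambda>x. \<phi> x $ i) \<eta>))\<^sup>2) \<le>
     (\<Sum>i\<in>UNIV. (C i)\<^sup>2) * (1 / (1 + (norm \<eta>)\<^sup>2) ^ 3)" for \<eta>
  proof -
    let ?j = "1 + (norm \<eta>)\<^sup>2"
    have j: "1 \<le> ?j" "0 < ?j" by (simp_all add: add_pos_nonneg)
    have "?j powr L * ?j ^ 3 \<le> ?j powr (2 * m)"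
    proof -
      have "?j powr L * ?j ^ 3 = ?j powr (L + 3)"
        using powr_realpow[OF j(2), of 3] by (simp only: powr_add) simp
      also have "\<dots> \<le> ?j powr (2 * m)"
      proof (rule powr_mono[OF _ j(1)])
        have "L + 3 \<le> real m" 
          using order_trans[OF abs_ge_self real_nat_ceiling_ge[of "\<bar>L\<bar>"]] by (simp add: m_def)
        then show "L + 3 \<le> real (2 * m)" by simp
      qed
      finally show ?thesis .
    qed
    also have "\<dots> = (?j ^ m)\<^sup>2"
      using j powr_realpow[of ?j "2 * m"] by (simp add: power_mult[symmetric] mult.commute)
    finally have jj: "?j powr L * ?j ^ 3 \<le> (?j ^ m)\<^sup>2" .
    have "?j powr L * (cmod (fourier (\<lambda>x. \<phi> x $ i) \<eta>))\<^sup>2 \<le> (C i)\<^sup>2 * (1 / ?j ^ 3)" for i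
    proof -
      have "?j powr L * ?j ^ 3 * (cmod (fourier (\<lambda>x. \<phi> x $ i) \<eta>))\<^sup>2 \<le> (?j ^ m)\<^sup>2 * (cmod (fourier (\<lambda>x. \<phi> x $ i) \<eta>))\<^sup>2"
        by (rule mult_right_mono[OF jj]) simp
      also have "\<dots> = (?j ^ m * cmod (fourier (\<lambda>x. \<phi> x $ i) \<eta>))\<^sup>2" by (simp add: power_mult_distrib)
      also have "\<dots> \<le> (C i)\<^sup>2" by (rule power_mono[OF C(2)]) simp
      finally show ?thesis using j by (simp add: pos_le_divide_eq ac_simps)
    qed
    then have "(\<Sum>i\<in>UNIV. ?j powr L * (cmod (fourier (\<lambda>x. \<phi> x $ i) \<eta>))\<^sup>2) \<le> (\<Sum>i\<in>UNIV. (C i)\<^sup>2 * (1 / ?j ^ 3))"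
      by (rule sum_mono)
    then show ?thesis by (simp add: sum_distrib_left sum_divide_distrib)
  qed
  then have "H_norm_sq L \<phi> \<le> (\<integral>\<^sup>+ \<eta>. ennreal ((\<Sum>i\<in>UNIV. (C i)\<^sup>2) * (1 / (1 + (norm (\<eta> :: real^3))\<^sup>2) ^ 3)) \<partial>lebesgue)"
    unfolding H_norm_sq_def by (intro nn_integral_mono ennreal_leI)
  also have "\<dots> = ennreal (\<Sum>i\<in>UNIV. (C i)\<^sup>2) * (\<integral>\<^sup>+ \<eta>. ennreal (1 / (1 + (norm (\<eta> :: real^3))\<^sup>2) ^ 3) \<partial>lborel)"
    unfolding nn_integral_completion
    by (subst ennreal_mult) (auto simp: sum_nonneg intro!: nn_integral_cmult)
  also have "\<dots> < \<infinity>"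
    using nn_integral_japanese_bracket_finite by (simp add: ennreal_mult_less_top)
  finally show ?thesis .
qed

lemma borel_measurable_fourier [measurable]:
  assumes [measurable]: "g \<in> borel_measurable borel"
  shows "fourier g \<in> borel_measurable borel"
proof -
  have "(\<lambda>\<eta>. LINT x|lborel. complex_of_real (g x) * cis (- (x \<bullet> \<eta>))) \<in> borel_measurable borel"
    unfolding cis_conv_exp by (intro lborel.borel_measurable_lebesgue_integral) measurable
  then show ?thesis
    by (simp add: fourier_lborel[OF assms, abs_def])
qed

text \<open>\<open>H_neg_norm\<close> tests only against fields with \<open>H_norm_sq\<close> at
  most 1; homogeneity brings a given test field into this unit ball.\<close>

lemma H_norm_sq_scaleR:
  assumes "test_function \<phi>"
  shows "H_norm_sq L (\<lambda>x. c *\<^sub>R \<phi> x) = ennreal (c\<^sup>2) * H_norm_sq L \<phi>"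
proof -
  have [measurable]: "(\<lambda>x. \<phi> x $ i) \<in> borel_measurable borel" for i
    by (rule test_function_borel[OF test_function_compose_linear[OF bounded_linear_vec_nth assms]])
  have F: "fourier (\<lambda>x. (c *\<^sub>R \<phi> x) $ i) \<eta> = of_real c * fourier (\<lambda>x. \<phi> x $ i) \<eta>" for i \<eta>
    by (simp add: fourier_def mult.assoc)
  have "H_norm_sq L (\<lambda>x. c *\<^sub>R \<phi> x) = (\<integral>\<^sup>+ \<eta>. ennreal (c\<^sup>2) * ennreal ((1 + (norm \<eta>)\<^sup>2) powr L *
     (\<Sum>i\<in>UNIV. (cmod (fourier (\<lambda>x. \<phi> x $ i) \<eta>))\<^sup>2)) \<partial>lebesgue)"
    unfolding H_norm_sq_def F
    by (intro nn_integral_cong)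
      (simp add: norm_mult power_mult_distrib sum_distrib_left[symmetric] mult.left_commute sum_nonneg
        flip: ennreal_mult)
  then show ?thesis
    unfolding H_norm_sq_def nn_integral_completion by (simp add: nn_integral_cmult)
qed

section \<open>Curls of bump fields and their pairing with the velocity\<close>

definition bump_field :: "real^3 \<Rightarrow> real \<Rightarrow> real^3 \<Rightarrow> real^3 \<Rightarrow> real^3" where
  "bump_field x0 R e x = flat_exp 1 1 (bump_arg x0 R x) *\<^sub>R e"

lemma test_function_bump_field: "0 < R \<Longrightarrow> test_function (bump_field x0 R e)"
  unfolding bump_field_def[abs_def] by (rule test_function_bump) (simp_all add: smooth_const)

text \<open>The curl of \<phi> e is the cross product of the gradient of \<phi> with e. Here
  \<open>monom 1 2\<close> is the derivative polynomial of exp(-1/s), and the factor -2/R^2 with x -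
  x0 is the gradient of \<open>bump_arg\<close>.\<close>

lemma curl_bump_field:
  "curl (bump_field x0 R e) x = (flat_exp 1 (monom 1 2) (bump_arg x0 R x) * (-2 / R\<^sup>2)) *\<^sub>R cross3 (x - x0) e"
proof -
  have "(bump_field x0 R e has_derivative
     (\<lambda>v. (flat_exp 1 (flat_exp_deriv 1 1) (bump_arg x0 R x) * (-2 / R\<^sup>2 * ((x - x0) \<bullet> v))) *\<^sub>R e)) (at x)"
    unfolding bump_field_def[abs_def]
    by (rule has_derivative_scaleR_left[OF bump_has_derivative]) simp
  then have D: "frechet_derivative (bump_field x0 R e) (at x) =
     (\<lambda>v. (flat_exp 1 (flat_exp_deriv 1 1) (bump_arg x0 R x) * (-2 / R\<^sup>2 * ((x - x0) \<bullet> v))) *\<^sub>R e)"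
    by (rule frechet_derivative_at[symmetric])
  have q: "flat_exp_deriv 1 1 = monom 1 2" by (simp add: flat_exp_deriv_def)
  show ?thesis
    unfolding curl_def D Let_def q
    by (simp add: cross3_def vec_eq_iff forall_3 inner_axis algebra_simps diff_divide_distrib add_divide_distrib)
qed

lemma norm_cross3_le: "norm (cross3 x y) \<le> norm x * norm y"
proof (rule power2_le_imp_le)
  show "(norm (cross3 x y))\<^sup>2 \<le> (norm x * norm y)\<^sup>2"
    by (simp add: norm_cross power_mult_distrib)
qed simp

text \<open>With x = 1/s the upper bound is x^2 exp(-x) \<le> 2, from the quadratic Taylor bound of
  the exponential.\<close>

lemma flat_exp_square_bounds: "0 \<le> flat_exp 1 (monom 1 2) s" "flat_exp 1 (monom 1 2) s \<le> 2"
proof -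
  have "(1 / s)\<^sup>2 * exp (- (1 / s)) \<le> 2" if "0 < s"
  proof -
    have "(1 / s)\<^sup>2 \<le> 2 * exp (1 / s)"
      using exp_lower_Taylor_quadratic[of "1 / s"] divide_pos_pos[OF zero_less_one that] by linarith
    then have "(1 / s)\<^sup>2 * exp (- (1 / s)) \<le> 2 * exp (1 / s) * exp (- (1 / s))"
      by (rule mult_right_mono) simp
    then show ?thesis by (simp add: mult.assoc flip: exp_add)
  qed
  then show "0 \<le> flat_exp 1 (monom 1 2) s" "flat_exp 1 (monom 1 2) s \<le> 2"
    by (simp_all add: flat_exp_def poly_monom)
qed

text \<open>The 8 is a product of three factors 2: the bound for x^2 exp(-x), the 2 in the gradient
  of \<open>bump_arg\<close>, and |x - x0| \<le> 2 R.\<close>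

lemma norm_curl_bump_field_le:
  assumes "0 < R" "norm e \<le> 1"
  shows "norm (curl (bump_field x0 R e) x) \<le> 8 / R * indicat_real (ball x0 (2 * R)) x"
proof (cases "x \<in> ball x0 (2 * R)")
  case True
  have "norm (curl (bump_field x0 R e) x) = flat_exp 1 (monom 1 2) (bump_arg x0 R x) * (2 / R\<^sup>2) * norm (cross3 (x - x0) e)"
    using flat_exp_square_bounds(1)[of "bump_arg x0 R x"] by (simp add: curl_bump_field abs_mult)
  also have "\<dots> \<le> 2 * (2 / R\<^sup>2) * (2 * R * 1)"
  proof (intro mult_mono)
    have "norm (x - x0) \<le> 2 * R" using True by (simp add: dist_norm norm_minus_commute)
    then show "norm (cross3 (x - x0) e) \<le> 2 * R * 1"
      using order_trans[OF norm_cross3_le mult_mono[of "norm (x - x0)" "2 * R" "norm e" 1]] assms by simp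
  qed (use flat_exp_square_bounds assms in auto)
  also have "\<dots> = 8 / R" using assms by (simp add: power2_eq_square)
  finally show ?thesis using True by simp
next
  case False
  then show ?thesis
    using bump_eq_0[OF assms(1) False] by (simp add: curl_bump_field)
qed

text \<open>The \<open>H\<^sup>-\<^sup>L\<close> bound is localised by cut-offs. Splitting \<open>exp (- 1 / s)\<close> into two factors
  \<open>exp (- 1 / (2 * s))\<close> provides the cut-off without a separate plateau function.\<close>

lemma curl_bump_field_factorization:
  fixes x0 e :: "real^3"
  assumes "0 < R"
  obtains \<zeta> :: "real^3 \<Rightarrow> real" and \<Phi> where "test_function \<zeta>" "test_function \<Phi>"
    "curl (bump_field x0 R e) = (\<lambda>x. \<zeta> x *\<^sub>R \<Phi> x)"
proof
  let ?\<zeta> = "\<lambda>x. flat_exp (1/2) 1 (bump_arg x0 R x) *\<^sub>R (1 :: real)"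
  let ?c = "\<lambda>x. (-2 / R\<^sup>2) *\<^sub>R cross3 (x - x0) e"
  let ?\<Phi> = "\<lambda>x. flat_exp (1/2) (monom 1 2) (bump_arg x0 R x) *\<^sub>R ?c x"
  show "test_function ?\<zeta>" by (rule test_function_bump) (use assms smooth_const in auto)
  have eq: "?c = (\<lambda>x. (-2 / R\<^sup>2) *\<^sub>R cross3 x e + (2 / R\<^sup>2) *\<^sub>R cross3 x0 e)"
    by (simp add: fun_eq_iff Cross3.left_diff_distrib scaleR_diff_right)
  have "bounded_linear (\<lambda>x. (-2 / R\<^sup>2) *\<^sub>R cross3 x e)"
    using bounded_bilinear.bounded_linear_left[OF bilinear_cross[unfolded bilinear_conv_bounded_bilinear], of e]
    by (rule bounded_linear_const_scaleR)
  then have lin: "smooth (\<lambda>x. (-2 / R\<^sup>2) *\<^sub>R cross3 x e + (2 / R\<^sup>2) *\<^sub>R cross3 x0 e)"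
    by (rule smooth_add[OF smooth_bounded_linear smooth_const])
  have "smooth ?c" by (rule back_subst[of smooth, OF lin eq[symmetric]])
  then show "test_function ?\<Phi>" by (rule test_function_bump[rotated 2]) (use assms in auto)
  have "flat_exp 1 (monom 1 2) s = flat_exp (1/2) 1 s * flat_exp (1/2) (monom 1 2) s" for s
    by (simp add: flat_exp_def exp_add[symmetric] mult.left_commute)
  then show "curl (bump_field x0 R e) = (\<lambda>x. ?\<zeta> x *\<^sub>R ?\<Phi> x)"
    by (simp add: curl_bump_field fun_eq_iff)
qed

section \<open>Integrability of the pairing and its continuity in time\<close>

lemma integrable_inner_L1_loc:
  assumes "L1_loc v" "W \<in> borel_measurable borel" "\<And>x. r < norm x \<Longrightarrow> W x = 0" "\<And>x. norm (W x) \<le> M"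
  shows "integrable lebesgue (\<lambda>x. v x \<bullet> W x)"
proof -
  have int: "integrable lebesgue (\<lambda>x. indicat_real (cball 0 r) x *\<^sub>R v x)"
    using assms(1) by (auto simp: L1_loc_def set_integrable_def)
  have eq: "v x \<bullet> W x = (indicat_real (cball 0 r) x *\<^sub>R v x) \<bullet> W x" for x
    using assms(3)[of x] by (auto simp: indicator_def)
  show ?thesis unfolding eq
  proof (rule Bochner_Integration.integrable_bound)
    show "integrable lebesgue (\<lambda>x. M * norm (indicat_real (cball 0 r) x *\<^sub>R v x))"
      using int by (intro integrable_mult_right integrable_norm)
    show "(\<lambda>x. (indicat_real (cball 0 r) x *\<^sub>R v x) \<bullet> W x) \<in> borel_measurable lebesgue"
    proof (rule borel_measurable_inner)
      show "W \<in> borel_measurable lebesgue" by (rule measurable_completion) (simp add: assms(2))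
    qed (rule borel_measurable_integrable[OF int])
    show "AE x in lebesgue. norm ((indicat_real (cball 0 r) x *\<^sub>R v x) \<bullet> W x) \<le> norm (M * norm (indicat_real (cball 0 r) x *\<^sub>R v x))"
    proof (rule AE_I2)
      fix x
      let ?a = "indicat_real (cball 0 r) x *\<^sub>R v x"
      have "norm (?a \<bullet> W x) \<le> norm ?a * norm (W x)" unfolding real_norm_def by (rule Cauchy_Schwarz_ineq2)
      also have "\<dots> \<le> norm ?a * M" by (rule mult_left_mono[OF assms(4)]) simp
      finally show "norm (?a \<bullet> W x) \<le> norm (M * norm ?a)"
        using abs_ge_self[of "norm ?a * M"] by (simp only: real_norm_def mult.commute[of M])
    qed
  qed
qed

lemma L2_loc_imp_L1_loc:
  assumes "L2_loc v" shows "L1_loc v"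
  unfolding L1_loc_def set_integrable_def
proof (intro allI impI)
  fix K :: "(real^3) set" assume K: "compact K"
  then have [measurable]: "K \<in> sets lebesgue" using lmeasurable_compact by auto
  have [measurable]: "v \<in> borel_measurable lebesgue" using assms by (simp add: L2_loc_def)
  show "integrable lebesgue (\<lambda>x. indicat_real K x *\<^sub>R v x)"
  proof (rule Bochner_Integration.integrable_bound)
    have "integrable lebesgue (\<lambda>x. indicat_real K x *\<^sub>R (norm (v x))\<^sup>2)"
      using assms K by (simp add: L2_loc_def set_integrable_def)
    moreover have "integrable lebesgue (indicat_real K)"
      using lmeasurable_compact[OF K] by (intro integrable_real_indicator) (auto simp: fmeasurable_def)
    ultimately show "integrable lebesgue (\<lambda>x. indicat_real K x + indicat_real K x *\<^sub>R (norm (v x))\<^sup>2)"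
      by (rule Bochner_Integration.integrable_add[rotated])
    show "AE x in lebesgue. norm (indicat_real K x *\<^sub>R v x) \<le> norm (indicat_real K x + indicat_real K x *\<^sub>R (norm (v x))\<^sup>2)"
    proof (rule AE_I2)
      fix x
      have "norm (v x) \<le> 1 + (norm (v x))\<^sup>2"
        using sum_squares_ge_zero[of "norm (v x) - 1/2" 0] by (simp add: power2_eq_square algebra_simps)
      then show "norm (indicat_real K x *\<^sub>R v x) \<le> norm (indicat_real K x + indicat_real K x *\<^sub>R (norm (v x))\<^sup>2)"
        by (auto simp: indicator_def)
    qed
  qed measurable
qed

text \<open>The cut-off \<open>\<zeta>\<close> moves to the side of the velocity, where the local
  Lipschitz bound controls it, and \<open>\<Phi>\<close> remains as the test field of the dual norm.
  The pairing is then even Lipschitz in time.\<close>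

lemma pairing_continuous_in_time:
  fixes \<zeta> :: "real^3 \<Rightarrow> real"
  assumes Lip: "bounded_Lip_H_neg_loc T L E u" and \<epsilon>: "\<epsilon> \<in> E"
    and L2: "\<And>t. t \<in> {0..T} \<Longrightarrow> L2_loc (u \<epsilon> t)"
    and test: "test_function \<zeta>" "test_function \<Phi>"
  shows "continuous_on {0..T} (\<lambda>t. LINT x|lebesgue. u \<epsilon> t x \<bullet> (\<zeta> x *\<^sub>R \<Phi> x))"
proof -
  let ?I = "\<lambda>t. LINT x|lebesgue. u \<epsilon> t x \<bullet> (\<zeta> x *\<^sub>R \<Phi> x)"
  obtain M where M: "\<And>s t. s \<in> {0..T} \<Longrightarrow> t \<in> {0..T} \<Longrightarrow>
      H_neg_norm L (\<lambda>x. \<zeta> x *\<^sub>R (u \<epsilon> t x - u \<epsilon> s x)) \<le> ennreal (M * \<bar>t - s\<bar>)"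
    using Lip test(1) \<epsilon> unfolding bounded_Lip_H_neg_loc_def by meson
  define H where "H = enn2real (H_norm_sq L \<Phi>)"
  have H: "H_norm_sq L \<Phi> = ennreal H" "0 \<le> H"
    using H_norm_sq_finite[OF test(2), of L] by (simp_all add: H_def)
  \<comment> \<open>Scales \<open>\<Phi>\<close> into the unit ball of H^L. Since H \<le> (1 + H)^2,
    this choice needs no square root and covers H = 0.\<close>
  define c where "c = 1 / (1 + H)"
  have c: "0 < c" using H by (simp add: c_def)
  have "c\<^sup>2 * H \<le> 1"
  proof -
    have "H \<le> (1 + H)\<^sup>2" using H by (simp add: power2_eq_square algebra_simps)
    then show ?thesis using H by (simp add: c_def power_divide pos_divide_le_eq)
  qed
  then have unit: "H_norm_sq L (\<lambda>x. c *\<^sub>R \<Phi> x) \<le> 1"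
    using H by (simp add: H_norm_sq_scaleR[OF test(2)] flip: ennreal_mult)
  have tc: "test_function (\<lambda>x. c *\<^sub>R \<Phi> x)"
    by (rule test_function_compose_linear[OF bounded_linear_scaleR_right test(2)])
  obtain r B where r: "\<And>x. r < norm x \<Longrightarrow> \<zeta> x = 0" and B: "0 < B" "\<And>x. norm (\<zeta> x) \<le> B"
    using test_function_bounds[OF test(1)] by metis
  obtain B' where B': "0 < B'" "\<And>x. norm (\<Phi> x) \<le> B'"
    using test_function_bounds[OF test(2)] by metis
  have int: "integrable lebesgue (\<lambda>x. u \<epsilon> t x \<bullet> (\<zeta> x *\<^sub>R \<Phi> x))" if "t \<in> {0..T}" for t
  proof (rule integrable_inner_L1_loc[OF L2_loc_imp_L1_loc[OF L2[OF that]]])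
    show "(\<lambda>x. \<zeta> x *\<^sub>R \<Phi> x) \<in> borel_measurable borel"
      by (intro borel_measurable_scaleR test_function_borel test)
    show "norm (\<zeta> x *\<^sub>R \<Phi> x) \<le> B * B'" for x
      using B B' by (auto intro!: mult_mono)
  qed (use r in auto)
  have "\<bar>?I t - ?I s\<bar> \<le> \<bar>M\<bar> / c * \<bar>t - s\<bar>" if st: "s \<in> {0..T}" "t \<in> {0..T}" for s t
  proof -
    have "ennreal \<bar>LINT x|lebesgue. (\<zeta> x *\<^sub>R (u \<epsilon> t x - u \<epsilon> s x)) \<bullet> (c *\<^sub>R \<Phi> x)\<bar> \<le> H_neg_norm L (\<lambda>x. \<zeta> x *\<^sub>R (u \<epsilon> t x - u \<epsilon> s x))"
      unfolding H_neg_norm_def by (rule SUP_upper) (use unit tc in simp)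
    also have "\<dots> \<le> ennreal (M * \<bar>t - s\<bar>)" by (rule M) fact+
    also have "\<dots> \<le> ennreal (\<bar>M\<bar> * \<bar>t - s\<bar>)" by (intro ennreal_leI mult_right_mono) auto
    finally have "\<bar>LINT x|lebesgue. (\<zeta> x *\<^sub>R (u \<epsilon> t x - u \<epsilon> s x)) \<bullet> (c *\<^sub>R \<Phi> x)\<bar> \<le> \<bar>M\<bar> * \<bar>t - s\<bar>"
      by (simp add: ennreal_le_iff)
    also have "(LINT x|lebesgue. (\<zeta> x *\<^sub>R (u \<epsilon> t x - u \<epsilon> s x)) \<bullet> (c *\<^sub>R \<Phi> x)) =
       (LINT x|lebesgue. c * (u \<epsilon> t x \<bullet> (\<zeta> x *\<^sub>R \<Phi> x) - u \<epsilon> s x \<bullet> (\<zeta> x *\<^sub>R \<Phi> x)))"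
      by (rule Bochner_Integration.integral_cong) (simp_all add: inner_diff_left algebra_simps)
    also have "\<dots> = c * (?I t - ?I s)"
      using int st by (simp only: integral_mult_right_zero Bochner_Integration.integral_diff)
    finally have "c * \<bar>?I t - ?I s\<bar> \<le> \<bar>M\<bar> * \<bar>t - s\<bar>"
      using c by (simp only: abs_mult abs_of_pos)
    then show ?thesis
      by (simp only: times_divide_eq_left pos_le_divide_eq[OF c] mult.commute[of _ c])
  qed
  then have "(\<bar>M\<bar> / c)-lipschitz_on {0..T} ?I"
    using c by (intro lipschitz_onI) (auto simp: dist_real_def abs_minus_commute)
  then show ?thesis by (rule lipschitz_on_continuous_on)
qed

section \<open>Square sums of the pairings over disjoint balls\<close>

lemma doubled_ball_averages_lebesgue:
  fixes g :: "'a::euclidean_space \<Rightarrow> ennreal" and \<B> :: "('a \<times> real) set"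
  assumes "g \<in> borel_measurable lebesgue"
    and "finite \<B>" and "\<And>x R. (x, R) \<in> \<B> \<Longrightarrow> 0 < R"
    and "disjoint_family_on (\<lambda>(x, R). ball x R) \<B>"
  shows "(\<Sum>(x, R)\<in>\<B>. ennreal (1 / R ^ DIM('a)) * (\<integral>\<^sup>+ y\<in>ball x (2 * R). g y \<partial>lebesgue)\<^sup>2) \<le>
    ennreal (8 * 20 ^ DIM('a) * unit_ball_vol (DIM('a))) * (\<integral>\<^sup>+ y. (g y)\<^sup>2 \<partial>lebesgue)"
proof -
  obtain g' where g': "g' \<in> borel_measurable lborel" "AE x in lborel. g x = g' x"
    using completion_ex_borel_measurable[OF assms(1)] by auto
  have "(\<integral>\<^sup>+ y\<in>ball x (2 * R). g y \<partial>lebesgue) = (\<integral>\<^sup>+ y\<in>ball x (2 * R). g' y \<partial>lborel)" for x R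
    unfolding nn_integral_completion by (rule nn_integral_cong_AE) (use g'(2) in \<open>eventually_elim, simp\<close>)
  moreover have "(\<integral>\<^sup>+ y. (g y)\<^sup>2 \<partial>lebesgue) = (\<integral>\<^sup>+ y. (g' y)\<^sup>2 \<partial>lborel)"
    unfolding nn_integral_completion by (rule nn_integral_cong_AE) (use g'(2) in \<open>eventually_elim, simp\<close>)
  ultimately show ?thesis
    using doubled_ball_averages_strong_type[of g' \<B>] g'(1) assms by simp
qed

definition maximal_const :: real where
  "maximal_const = 8 * 20 ^ 3 * unit_ball_vol 3"

text \<open>The scaling closes exactly: the curl has size at most 8 / R, so the square of a pairing
  divided by R is at most 64 R^(-3) times the square of the integral of |v| over the doubled ball,
  and R^(-3) is the weight of the maximal inequality in dimension 3. Nothing is asked of the vectors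
  \<open>e\<close> beyond their length.\<close>

lemma pairing_square_sum_le:
  fixes v :: "real^3 \<Rightarrow> real^3"
  assumes v: "L2_loc v" and fin: "finite \<B>" and pos: "\<And>x R. (x, R) \<in> \<B> \<Longrightarrow> 0 < R"
    and disj: "disjoint_family_on (\<lambda>(x, R). ball x R) \<B>"
    and K: "K \<in> sets lebesgue" "\<And>x R. (x, R) \<in> \<B> \<Longrightarrow> ball x (2 * R) \<subseteq> K"
    and e: "\<And>p. norm (e p) \<le> 1" and M: "0 \<le> M" "(\<integral>\<^sup>+ x\<in>K. ennreal ((norm (v x))\<^sup>2) \<partial>lebesgue) \<le> ennreal M"
  shows "(\<Sum>(x, R)\<in>\<B>. (LINT y|lebesgue. v y \<bullet> curl (bump_field x R (e (x, R))) y)\<^sup>2 / R) \<le> 64 * maximal_const * M"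
proof -
  \<comment> \<open>The energy is bounded only locally, so |v| is cut off to \<open>K\<close>; on
    the doubled balls, which lie in \<open>K\<close>, this changes nothing.\<close>
  define g where "g y = ennreal (norm (v y)) * indicator K y" for y
  have [measurable]: "v \<in> borel_measurable lebesgue" "K \<in> sets lebesgue"
    using v K by (auto simp: L2_loc_def)
  have g: "g \<in> borel_measurable lebesgue" unfolding g_def[abs_def] by measurable
  have "ennreal ((LINT y|lebesgue. v y \<bullet> curl (bump_field x R (e (x, R))) y)\<^sup>2 / R) \<le>
      ennreal 64 * (ennreal (1 / R ^ 3) * (\<integral>\<^sup>+ y\<in>ball x (2 * R). g y \<partial>lebesgue)\<^sup>2)" if "(x, R) \<in> \<B>" for x R
  proof -
    let ?W = "curl (bump_field x R (e (x, R)))"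
    let ?b = "LINT y|lebesgue. v y \<bullet> ?W y"
    have R: "0 < R" by (rule pos[OF that])
    have "ennreal \<bar>?b\<bar> \<le> (\<integral>\<^sup>+ y. ennreal (norm (v y \<bullet> ?W y)) \<partial>lebesgue)"
    \<comment> \<open>The integral of a non-integrable function is 0 by convention, which satisfies
      the bound as well.\<close>
    proof (cases "integrable lebesgue (\<lambda>y. v y \<bullet> ?W y)")
      case True
      then show ?thesis using integral_norm_bound_ennreal[OF True] by simp
    qed (simp add: not_integrable_integral_eq)
    also have "\<dots> \<le> (\<integral>\<^sup>+ y. ennreal (8 / R) * (g y * indicator (ball x (2 * R)) y) \<partial>lebesgue)"
    proof (rule nn_integral_mono)
      fix y
      have "norm (v y \<bullet> ?W y) \<le> norm (v y) * (8 / R * indicat_real (ball x (2 * R)) y)"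
        using order_trans[OF Cauchy_Schwarz_ineq2 mult_left_mono[OF norm_curl_bump_field_le[OF R e]]] by simp
      then have "ennreal (norm (v y \<bullet> ?W y)) \<le> ennreal (8 / R * (norm (v y) * indicat_real (ball x (2 * R)) y))"
        by (intro ennreal_leI) (simp add: ac_simps)
      also have "\<dots> = ennreal (8 / R) * (g y * indicator (ball x (2 * R)) y)"
      proof (cases "y \<in> ball x (2 * R)")
        case True
        then have "y \<in> K" using K(2)[OF that] by auto
        then show ?thesis using True R by (simp add: g_def flip: ennreal_mult)
      qed simp
      finally show "ennreal (norm (v y \<bullet> ?W y)) \<le> ennreal (8 / R) * (g y * indicator (ball x (2 * R)) y)" .
    qed
    also have "\<dots> = ennreal (8 / R) * (\<integral>\<^sup>+ y\<in>ball x (2 * R). g y \<partial>lebesgue)"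
      by (intro nn_integral_cmult borel_measurable_times_ennreal g borel_measurable_indicator
          fmeasurableD[OF lmeasurable_ball])
    finally have "(ennreal \<bar>?b\<bar>)\<^sup>2 \<le> (ennreal (8 / R) * (\<integral>\<^sup>+ y\<in>ball x (2 * R). g y \<partial>lebesgue))\<^sup>2"
      by (rule power_mono) simp
    then have "ennreal (1 / R) * (ennreal \<bar>?b\<bar>)\<^sup>2 \<le> ennreal (1 / R) * (ennreal (8 / R) * (\<integral>\<^sup>+ y\<in>ball x (2 * R). g y \<partial>lebesgue))\<^sup>2"
      by (rule mult_left_mono) simp
    also have "\<dots> = ennreal (1 / R * (8 / R)\<^sup>2) * (\<integral>\<^sup>+ y\<in>ball x (2 * R). g y \<partial>lebesgue)\<^sup>2"
    proof -
      have "ennreal (1 / R * (8 / R)\<^sup>2) = ennreal (1 / R) * (ennreal (8 / R))\<^sup>2"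
        using R by (subst ennreal_mult) (simp_all add: ennreal_power)
      then show ?thesis by (simp only: power_mult_distrib mult.assoc)
    qed
    also have "1 / R * (8 / R)\<^sup>2 = 64 * (1 / R ^ 3)"
      by (simp add: power2_eq_square power3_eq_cube)
    also have "ennreal (64 * (1 / R ^ 3)) = ennreal 64 * ennreal (1 / R ^ 3)"
      using R by (subst ennreal_mult) simp_all
    also have "ennreal (1 / R) * (ennreal \<bar>?b\<bar>)\<^sup>2 = ennreal (?b\<^sup>2 / R)"
      using R by (simp add: ennreal_power flip: ennreal_mult)
    finally show ?thesis by (simp only: mult.assoc)
  qed
  then have "(\<Sum>(x, R)\<in>\<B>. ennreal ((LINT y|lebesgue. v y \<bullet> curl (bump_field x R (e (x, R))) y)\<^sup>2 / R)) \<le>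
     (\<Sum>(x, R)\<in>\<B>. ennreal 64 * (ennreal (1 / R ^ 3) * (\<integral>\<^sup>+ y\<in>ball x (2 * R). g y \<partial>lebesgue)\<^sup>2))"
    by (intro sum_mono) auto
  also have "\<dots> = ennreal 64 * (\<Sum>(x, R)\<in>\<B>. ennreal (1 / R ^ 3) * (\<integral>\<^sup>+ y\<in>ball x (2 * R). g y \<partial>lebesgue)\<^sup>2)"
    by (simp only: sum_distrib_left case_prod_unfold)
  also have "\<dots> \<le> ennreal 64 * (ennreal maximal_const * (\<integral>\<^sup>+ y. (g y)\<^sup>2 \<partial>lebesgue))"
    using doubled_ball_averages_lebesgue[OF g fin pos disj]
    by (intro mult_left_mono) (simp_all add: maximal_const_def)
  also have "(\<integral>\<^sup>+ y. (g y)\<^sup>2 \<partial>lebesgue) = (\<integral>\<^sup>+ x\<in>K. ennreal ((norm (v x))\<^sup>2) \<partial>lebesgue)"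
    by (intro nn_integral_cong) (auto simp: g_def indicator_def ennreal_power)
  also have "ennreal 64 * (ennreal maximal_const * \<dots>) \<le> ennreal 64 * (ennreal maximal_const * ennreal M)"
    using M by (intro mult_left_mono) auto
  also have "\<dots> = ennreal (64 * maximal_const * M)"
  proof -
    have "0 \<le> maximal_const" by (simp add: maximal_const_def)
    then show ?thesis
      using M(1) by (simp only: ennreal_mult[symmetric] mult_nonneg_nonneg mult.assoc zero_le_numeral)
  qed
  finally have "ennreal (\<Sum>(x, R)\<in>\<B>. (LINT y|lebesgue. v y \<bullet> curl (bump_field x R (e (x, R))) y)\<^sup>2 / R)
      \<le> ennreal (64 * maximal_const * M)"
    using pos by (subst sum_ennreal[symmetric]) (auto simp: case_prod_unfold intro!: divide_nonneg_pos)
  then show ?thesis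
    using M by (subst (asm) ennreal_le_iff) (auto simp: maximal_const_def)
qed

text \<open>A set of full measure is dense because a nondegenerate interval is not
  negligible.\<close>

lemma AE_lebesgue_on_interval_dense:
  fixes T t d :: real
  assumes "0 < T" "AE s in lebesgue_on {0..T}. P s" "t \<in> {0..T}" "0 < d"
  obtains s where "s \<in> {0..T}" "P s" "\<bar>s - t\<bar> < d"
proof -
  \<comment> \<open>Clipping at 0 and T keeps the interval nondegenerate also when t is an endpoint;
    d / 2 gives the strict inequality at the end.\<close>
  define a b where "a = max 0 (t - d / 2)" and "b = min T (t + d / 2)"
  have ab: "a < b" "{a..b} \<subseteq> {0..T}" using assms by (auto simp: a_def b_def)
  have "AE s in lebesgue. s \<in> {0..T} \<longrightarrow> P s"
    using assms(2) by (subst (asm) AE_restrict_space_iff) auto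
  then have "\<exists>s\<in>{a..b}. P s"
  proof (rule contrapos_pp)
    assume "\<not> (\<exists>s\<in>{a..b}. P s)"
    then have sub: "{a..b} \<subseteq> {s. \<not> (s \<in> {0..T} \<longrightarrow> P s)}" using ab by auto
    show "\<not> (AE s in lebesgue. s \<in> {0..T} \<longrightarrow> P s)"
    proof
      assume "AE s in lebesgue. s \<in> {0..T} \<longrightarrow> P s"
      then obtain N where "N \<in> null_sets lebesgue" "{s. \<not> (s \<in> {0..T} \<longrightarrow> P s)} \<subseteq> N"
        by (auto simp: eventually_ae_filter)
      then have "negligible {a..b}"
        using sub by (meson negligible_iff_null_sets negligible_subset subset_trans)
      then show False 
        using ab(1) negligible_interval(1)[of a b] by (simp add: cbox_interval box_real)
    qed
  qed
  then obtain s where "s \<in> {a..b}" "P s" by auto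
  then show thesis
    using that[of s] ab assms by (auto simp: a_def b_def abs_less_iff)
qed

text \<open>By continuity a violation at time t would persist on a neighbourhood of t, and this
  contains times at which the energy bound holds. The constant is fixed before the collection and
  the vectors, which may therefore depend on the time.\<close>

lemma pairing_square_sum_le_all_times:
  assumes "0 < T" "approximate_solutions T E u" "compact K"
  obtains M where "0 \<le> M"
    "\<And>\<epsilon> t \<B> e. \<lbrakk>\<epsilon> \<in> E; t \<in> {0..T}; finite \<B>; \<And>x R. (x, R) \<in> \<B> \<Longrightarrow> 0 < R;
      disjoint_family_on (\<lambda>(x, R). ball x R) \<B>; \<And>x R. (x, R) \<in> \<B> \<Longrightarrow> ball x (2 * R) \<subseteq> K;
      \<And>p. norm (e p) \<le> 1\<rbrakk> \<Longrightarrow>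
      (\<Sum>(x, R)\<in>\<B>. (LINT y|lebesgue. u \<epsilon> t y \<bullet> curl (bump_field x R (e (x, R))) y)\<^sup>2 / R) \<le> M"
proof -
  have L2: "\<And>\<epsilon> t. \<epsilon> \<in> E \<Longrightarrow> t \<in> {0..T} \<Longrightarrow> L2_loc (u \<epsilon> t)"
    and bdd: "bounded_Linf_L2_loc T E u" and "\<exists>L>1. bounded_Lip_H_neg_loc T L E u"
    using assms(2) by (auto simp: approximate_solutions_def)
  then obtain L where Lip: "bounded_Lip_H_neg_loc T L E u" by auto
  obtain M0 where M0: "\<And>\<epsilon>. \<epsilon> \<in> E \<Longrightarrow> AE t in lebesgue_on {0..T}.
      (\<integral>\<^sup>+ x\<in>K. ennreal ((norm (u \<epsilon> t x))\<^sup>2) \<partial>lebesgue) \<le> ennreal M0"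
    using bdd assms(3) unfolding bounded_Linf_L2_loc_def by meson
  define M where "M = 64 * maximal_const * max 0 M0"
  have K: "K \<in> sets lebesgue" using lmeasurable_compact[OF assms(3)] by auto
  show thesis
  proof
    show "0 \<le> M" by (simp add: M_def maximal_const_def)
    fix \<epsilon> t and \<B> :: "((real^3) \<times> real) set" and e :: "(real^3) \<times> real \<Rightarrow> real^3"
    assume H: "\<epsilon> \<in> E" "t \<in> {0..T}" "finite \<B>" "\<And>x R. (x, R) \<in> \<B> \<Longrightarrow> 0 < R"
      "disjoint_family_on (\<lambda>(x, R). ball x R) \<B>" "\<And>x R. (x, R) \<in> \<B> \<Longrightarrow> ball x (2 * R) \<subseteq> K"
      "\<And>p. norm (e p) \<le> 1"
    \<comment> \<open>Only the velocity varies with \<open>s\<close>; the balls and the vectors,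
      possibly adapted to the time \<open>t\<close>, stay fixed.\<close>
    define F where "F s = (\<Sum>(x, R)\<in>\<B>. (LINT y|lebesgue. u \<epsilon> s y \<bullet> curl (bump_field x R (e (x, R))) y)\<^sup>2 / R)" for s
    have b: "continuous_on {0..T} (\<lambda>s. LINT y|lebesgue. u \<epsilon> s y \<bullet> curl (bump_field x R (e (x, R))) y)"
      if xR: "(x, R) \<in> \<B>" for x R
    proof -
      obtain \<zeta> :: "real^3 \<Rightarrow> real" and \<Phi> where z: "test_function \<zeta>" "test_function \<Phi>"
          "curl (bump_field x R (e (x, R))) = (\<lambda>y. \<zeta> y *\<^sub>R \<Phi> y)"
        using curl_bump_field_factorization[OF H(4)[OF xR]] by metis
      show ?thesis
        unfolding z(3) by (rule pairing_continuous_in_time[OF Lip H(1) L2[OF H(1)] z(1,2)])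
    qed
    have F: "continuous_on {0..T} F"
      unfolding F_def[abs_def] case_prod_unfold
    proof (intro continuous_on_sum continuous_on_divide continuous_on_power continuous_on_const ballI)
      fix p assume "p \<in> \<B>"
      then show "continuous_on {0..T} (\<lambda>s. LINT y|lebesgue. u \<epsilon> s y \<bullet> curl (bump_field (fst p) (snd p) (e (fst p, snd p))) y)"
        "snd p \<noteq> 0"
        using b[of "fst p" "snd p"] H(4)[of "fst p" "snd p"] by auto
    qed
    show "F t \<le> M" unfolding F_def[symmetric]
    proof (rule ccontr)
      assume "\<not> F t \<le> M"
      then obtain d where d: "0 < d" "\<And>s. s \<in> {0..T} \<Longrightarrow> dist s t < d \<Longrightarrow> dist (F s) (F t) < F t - M"
      proof -
        have "0 < F t - M" using \<open>\<not> F t \<le> M\<close> by simp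
        with F H(2) that show ?thesis unfolding continuous_on_iff by blast
      qed
      obtain s where s: "s \<in> {0..T}"
          "(\<integral>\<^sup>+ x\<in>K. ennreal ((norm (u \<epsilon> s x))\<^sup>2) \<partial>lebesgue) \<le> ennreal M0" "\<bar>s - t\<bar> < d"
        by (rule AE_lebesgue_on_interval_dense[OF assms(1) M0[OF H(1)] H(2) d(1)])
      have "F s \<le> M" unfolding F_def M_def
      proof (rule pairing_square_sum_le[OF L2[OF H(1) s(1)] H(3-5) K H(6,7)])
        show "(\<integral>\<^sup>+ x\<in>K. ennreal ((norm (u \<epsilon> s x))\<^sup>2) \<partial>lebesgue) \<le> ennreal (max 0 M0)"
          using s(2) by (rule order_trans) (simp add: ennreal_leI)
      qed auto
      then show False using d(2)[OF s(1)] s(3) by (simp add: dist_real_def)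
    qed
  qed
qed

section \<open>Alignment and the local vorticity estimate\<close>

text \<open>For unit vectors |f - e|^2 = 2 - 2 f . e, so a distance of at most sqrt 2 times
  \<theta>, with 0 \<le> \<theta> < 1, means a cosine of at least 1 - \<theta>^2, which is the
  constant \<open>c\<close>. As \<open>e\<close> serves the direction at any one point of the
  doubled ball where the vorticity exceeds \<open>K0\<close>. Where it does not, both
  \<open>c * norm\<close> and the inner product are at most \<open>K0\<close> in absolute value,
  hence the term \<open>2 * K0\<close>.\<close>

lemma locally_aligned_direction:
  assumes "locally_aligned T E \<omega>"
  obtains K0 \<delta> c where "0 < K0" "0 < \<delta>" "0 < c" "c \<le> 1"
    "\<And>\<epsilon> t x R. \<epsilon> \<in> E \<Longrightarrow> t \<in> {0..T} \<Longrightarrow> 4 * R \<le> \<delta> \<Longrightarrow>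
      \<exists>e. norm e \<le> 1 \<and> (\<forall>y\<in>ball x (2 * R). c * norm (\<omega> \<epsilon> t y) \<le> \<omega> \<epsilon> t y \<bullet> e + 2 * K0)"
proof -
  obtain K0 \<delta> \<theta> where A: "0 < K0" "0 < \<delta>" "\<theta> < 1" and al:
    "\<And>\<epsilon> t x y. \<epsilon> \<in> E \<Longrightarrow> t \<in> {0..T} \<Longrightarrow> K0 < norm (\<omega> \<epsilon> t x) \<Longrightarrow> K0 < norm (\<omega> \<epsilon> t y) \<Longrightarrow> dist x y \<le> \<delta> \<Longrightarrow>
        norm (direction (\<omega> \<epsilon> t x) - direction (\<omega> \<epsilon> t y)) \<le> sqrt 2 * \<theta>"
    using assms unfolding locally_aligned_def by metis
  \<comment> \<open>\<open>\<theta>\<close> is bounded only from above, and a very negative value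
    would have a large square; the maximum with 0 prevents this and weakens the alignment bound
    harmlessly.\<close>
  define c where "c = 1 - (max \<theta> 0)\<^sup>2"
  have c: "0 < c" "c \<le> 1" using A(3) by (auto simp: c_def power_less_one_iff max_def abs_square_less_1)
  show thesis
  proof (rule that[OF A(1,2) c])
    fix \<epsilon> t x R assume H: "\<epsilon> \<in> E" "t \<in> {0..T}" "4 * R \<le> \<delta>"
    let ?w = "\<omega> \<epsilon> t"
    have small: "c * norm (?w y) \<le> ?w y \<bullet> e + 2 * K0" if "norm (?w y) \<le> K0" "norm e \<le> 1" for y e
    proof -
      have "\<bar>?w y \<bullet> e\<bar> \<le> norm (?w y) * 1"
        using order_trans[OF Cauchy_Schwarz_ineq2 mult_left_mono[OF that(2) norm_ge_zero]] .
      moreover have "c * norm (?w y) \<le> 1 * norm (?w y)" using c by (intro mult_right_mono) auto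
      ultimately show ?thesis using that(1) by linarith
    qed
    show "\<exists>e. norm e \<le> 1 \<and> (\<forall>y\<in>ball x (2 * R). c * norm (?w y) \<le> ?w y \<bullet> e + 2 * K0)"
    proof (cases "\<exists>z\<in>ball x (2 * R). K0 < norm (?w z)")
      case True
      then obtain z where z: "z \<in> ball x (2 * R)" "K0 < norm (?w z)" by auto
      let ?e = "direction (?w z)"
      have unit: "norm (direction (?w y)) = 1" if "K0 < norm (?w y)" for y
      proof -
        have "norm (?w y) \<noteq> 0" using that A(1) by linarith
        then show ?thesis by (simp add: direction_def)
      qed
      have "c * norm (?w y) \<le> ?w y \<bullet> ?e + 2 * K0" if y: "y \<in> ball x (2 * R)" for y
      proof (cases "K0 < norm (?w y)")
        case big: True
        let ?f = "direction (?w y)"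
        \<comment> \<open>Two points of the doubled ball are less than 4 R apart, which is where the
          restriction on the radius enters.\<close>
        have "dist y z \<le> \<delta>" using y z(1) H(3) dist_triangle2[of y z x] by (simp add: dist_commute)
        then have le: "norm (?f - ?e) \<le> sqrt 2 * \<theta>" using al H big z(2) by blast
        also have "\<dots> \<le> sqrt 2 * max \<theta> 0" by simp
        finally have "(norm (?f - ?e))\<^sup>2 \<le> (sqrt 2 * max \<theta> 0)\<^sup>2" by (rule power_mono) simp
        then have "2 - 2 * (?f \<bullet> ?e) \<le> 2 * (max \<theta> 0)\<^sup>2"
          using unit[OF big] unit[OF z(2)]
          by (simp add: power_mult_distrib power2_norm_eq_inner inner_diff_left inner_diff_right inner_commute norm_eq_1)
        then have "c \<le> ?f \<bullet> ?e" by (simp add: c_def)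
        then have "norm (?w y) * c \<le> norm (?w y) * (?f \<bullet> ?e)" by (rule mult_left_mono) simp
        also have "norm (?w y) * (?f \<bullet> ?e) = ?w y \<bullet> ?e"
        proof -
          have "norm (?w y) \<noteq> 0" using big A(1) by linarith
          then show ?thesis by (simp add: direction_def[of "?w y"])
        qed
        finally show ?thesis using A(1) by (simp add: mult.commute)
      next
        case False
        then show ?thesis using small unit[OF z(2)] by simp
      qed
      then show ?thesis using unit[OF z(2)] by (intro exI[of _ ?e]) auto
    next
      case False
      \<comment> \<open>Without large vorticity in the doubled ball the zero vector serves; this is
        why \<open>e\<close> is only required to have norm at most 1.\<close>
      then show ?thesis using small[of _ 0] by (intro exI[of _ 0]) (auto simp: not_less)
    qed
  qed
qed

lemma L1_loc_integrable_ball: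
  assumes "L1_loc w"
  shows "integrable lebesgue (\<lambda>y. indicat_real (ball x R) y * norm (w y))"
proof -
  have "set_integrable lebesgue (cball x R) w" using assms by (simp add: L1_loc_def)
  then have "set_integrable lebesgue (ball x R) w" by (rule set_integrable_subset) auto
  then show ?thesis
    unfolding set_integrable_def by (drule_tac integrable_norm) simp
qed

text \<open>The alignment inequality is multiplied by the bump, which lies between 0 and 1 and is at
  least exp(-1/3) on the inner ball, and then integrated; the definition of the vorticity moves the
  curl to the bump field. The 16 is 2 * 8, from \<open>2 * K0\<close> times the volume of the
  doubled ball.\<close>

lemma vorticity_ball_le:
  assumes vort: "is_vorticity v w" and R: "0 < R" and K0: "0 \<le> K0" and c: "0 < c"
    and al: "\<And>y. y \<in> ball x (2 * R) \<Longrightarrow> c * norm (w y) \<le> w y \<bullet> e + 2 * K0"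
  shows "c * exp (- 1 / 3) * (LINT y|lebesgue. indicat_real (ball x R) y * norm (w y)) \<le>
    \<bar>LINT y|lebesgue. v y \<bullet> curl (bump_field x R e) y\<bar> + 16 * unit_ball_vol 3 * K0 * R ^ 3"
proof -
  let ?\<phi> = "\<lambda>y. flat_exp 1 1 (bump_arg x R y)"
  have w: "L1_loc w" using vort by (simp add: is_vorticity_def)
  have tf: "test_function (bump_field x R e)" by (rule test_function_bump_field[OF R])
  obtain r M where rM: "\<And>y. r < norm y \<Longrightarrow> bump_field x R e y = 0" "\<And>y. norm (bump_field x R e y) \<le> M"
    using test_function_bounds[OF tf] by metis
  have int1: "integrable lebesgue (\<lambda>y. w y \<bullet> bump_field x R e y)"
    by (rule integrable_inner_L1_loc[OF w test_function_borel[OF tf] rM])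
  have int2: "integrable lebesgue (\<lambda>y. 2 * K0 * indicat_real (ball x (2 * R)) y)"
    using emeasure_lborel_ball_finite[of x "2 * R"] by (intro integrable_mult_right integrable_real_indicator) auto
  have int0: "integrable lebesgue (\<lambda>y. indicat_real (ball x R) y * norm (w y))"
    by (rule L1_loc_integrable_ball[OF w])
  have phi: "0 \<le> ?\<phi> y" "?\<phi> y \<le> 1" for y by (auto simp: flat_exp_def)
  have phi_ball: "exp (- 1 / 3) \<le> ?\<phi> y" if "y \<in> ball x R" for y
  proof -
    have "(norm (y - x))\<^sup>2 \<le> R\<^sup>2" using that R by (intro power_mono) (auto simp: dist_norm norm_minus_commute)
    then have "3 \<le> bump_arg x R y" using R by (simp add: bump_arg_def)
    then show ?thesis by (simp add: flat_exp_def field_simps)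
  qed
  have "c * exp (- 1 / 3) * (indicat_real (ball x R) y * norm (w y)) \<le>
     w y \<bullet> bump_field x R e y + 2 * K0 * indicat_real (ball x (2 * R)) y" for y
  proof (cases "y \<in> ball x (2 * R)")
    case True
    have "c * exp (- 1 / 3) * (indicat_real (ball x R) y * norm (w y)) \<le> ?\<phi> y * (c * norm (w y))"
    proof (cases "y \<in> ball x R")
      case True
      then show ?thesis using mult_right_mono[OF phi_ball[OF True], of "c * norm (w y)"] c by (simp add: ac_simps)
    qed (use c phi in simp)
    also have "\<dots> \<le> ?\<phi> y * (w y \<bullet> e + 2 * K0)" by (rule mult_left_mono[OF al[OF True] phi(1)])
    also have "\<dots> \<le> ?\<phi> y * (w y \<bullet> e) + 2 * K0"
      using mult_right_mono[OF phi(2)[of y], of "2 * K0"] K0 by (simp add: distrib_left)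
    finally show ?thesis using True by (simp add: bump_field_def)
  next
    case False
    then have "y \<notin> ball x R" using R by auto
    then show ?thesis using bump_eq_0[OF R False] False by (simp add: bump_field_def)
  qed
  then have le: "(LINT y|lebesgue. c * exp (- 1 / 3) * (indicat_real (ball x R) y * norm (w y))) \<le>
     (LINT y|lebesgue. w y \<bullet> bump_field x R e y + 2 * K0 * indicat_real (ball x (2 * R)) y)"
    using int0 int1 int2 by (intro integral_mono Bochner_Integration.integrable_add integrable_mult_right) auto
  have "c * exp (- 1 / 3) * (LINT y|lebesgue. indicat_real (ball x R) y * norm (w y)) =
     (LINT y|lebesgue. c * exp (- 1 / 3) * (indicat_real (ball x R) y * norm (w y)))"
    by (simp only: integral_mult_right_zero)
  also note le
  also have "(LINT y|lebesgue. w y \<bullet> bump_field x R e y + 2 * K0 * indicat_real (ball x (2 * R)) y) =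
     (LINT y|lebesgue. v y \<bullet> curl (bump_field x R e) y) + 2 * K0 * measure lebesgue (ball x (2 * R))"
    using int1 int2 vort tf by (simp add: Bochner_Integration.integral_add is_vorticity_def)
  also have "measure lebesgue (ball x (2 * R)) = 8 * unit_ball_vol 3 * R ^ 3"
    using R by (simp add: content_ball power_mult_distrib)
  also have "(LINT y|lebesgue. v y \<bullet> curl (bump_field x R e) y) + 2 * K0 * (8 * unit_ball_vol 3 * R ^ 3) \<le>
      \<bar>LINT y|lebesgue. v y \<bullet> curl (bump_field x R e) y\<bar> + 16 * unit_ball_vol 3 * K0 * R ^ 3"
    by simp
  finally show ?thesis .
qed

section \<open>The Morrey-type norm of the vorticity\<close>

definition ball_mass :: "(real^3 \<Rightarrow> real^3) \<Rightarrow> (real^3) \<times> real \<Rightarrow> real" where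
  "ball_mass w p = (LINT y|lebesgue. indicat_real (ball (fst p) (snd p)) y * norm (w y))"

lemma ball_mass_nonneg: "0 \<le> ball_mass w p"
  unfolding ball_mass_def by (rule integral_nonneg_AE) simp

lemma nn_integral_ball_mass:
  assumes "L1_loc w"
  shows "(\<integral>\<^sup>+ y\<in>ball x R. ennreal (norm (w y)) \<partial>lebesgue) = ennreal (ball_mass w (x, R))"
proof -
  have "(\<integral>\<^sup>+ y\<in>ball x R. ennreal (norm (w y)) \<partial>lebesgue)
      = (\<integral>\<^sup>+ y. ennreal (indicat_real (ball x R) y * norm (w y)) \<partial>lebesgue)"
    by (intro nn_integral_cong) (simp add: indicator_def)
  also have "\<dots> = ennreal (ball_mass w (x, R))"
    unfolding ball_mass_def using L1_loc_integrable_ball[OF assms, of x R] by (subst nn_integral_eq_integral) auto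
  finally show ?thesis .
qed

lemma sum_ball_indicator_le:
  assumes "finite \<B>" "disjoint_family_on (\<lambda>(x, R). ball x R) \<B>"
    and "\<And>x R. (x, R) \<in> \<B> \<Longrightarrow> ball x R \<subseteq> B"
  shows "(\<Sum>p\<in>\<B>. indicat_real (ball (fst p) (snd p)) y) \<le> indicat_real B y"
proof (cases "\<exists>p\<in>\<B>. y \<in> ball (fst p) (snd p)")
  case True
  then obtain p where p: "p \<in> \<B>" "y \<in> ball (fst p) (snd p)" by auto
  have "y \<notin> ball (fst q) (snd q)" if "q \<in> \<B> - {p}" for q
    using assms(2) that p unfolding disjoint_family_on_def case_prod_unfold by blast
  then have "(\<Sum>q\<in>\<B> - {p}. indicat_real (ball (fst q) (snd q)) y) = 0"
    by (intro sum.neutral) simp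
  moreover have "y \<in> B" using assms(3)[of "fst p" "snd p"] p by auto
  ultimately show ?thesis
    using p by (simp add: sum.remove[OF assms(1) p(1)])
next
  case False
  then have "(\<Sum>p\<in>\<B>. indicat_real (ball (fst p) (snd p)) y) = 0" by (intro sum.neutral) auto
  then show ?thesis by simp
qed

lemma sum_ball_mass_le:
  assumes "finite \<B>" "disjoint_family_on (\<lambda>(x, R). ball x R) \<B>" "L1_loc w"
    and "\<And>x R. (x, R) \<in> \<B> \<Longrightarrow> ball x R \<subseteq> ball 0 N"
  shows "(\<Sum>p\<in>\<B>. ball_mass w p) \<le> ball_mass w (0, N)"
proof -
  have "(\<Sum>p\<in>\<B>. ball_mass w p) = (LINT y|lebesgue. (\<Sum>p\<in>\<B>. indicat_real (ball (fst p) (snd p)) y * norm (w y)))"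
    unfolding ball_mass_def
    by (rule Bochner_Integration.integral_sum[symmetric]) (rule L1_loc_integrable_ball[OF assms(3)])
  also have "\<dots> \<le> ball_mass w (0, N)"
    unfolding ball_mass_def fst_conv snd_conv
  proof (rule integral_mono)
    fix y
    show "(\<Sum>p\<in>\<B>. indicat_real (ball (fst p) (snd p)) y * norm (w y)) \<le> indicat_real (ball 0 N) y * norm (w y)"
      unfolding sum_distrib_right[symmetric]
      by (rule mult_right_mono[OF sum_ball_indicator_le[OF assms(1,2,4)]]) simp_all
  qed (intro Bochner_Integration.integrable_sum L1_loc_integrable_ball[OF assms(3)])+
  finally show ?thesis .
qed

text \<open>Volume comparison for disjoint balls; it sums the errors that come from small
  vorticity.\<close>

lemma sum_cubed_radii_le:
  fixes \<B> :: "((real^3) \<times> real) set"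
  assumes "finite \<B>" "disjoint_family_on (\<lambda>(x, R). ball x R) \<B>"
    and pos: "\<And>x R. (x, R) \<in> \<B> \<Longrightarrow> 0 < R" and "0 \<le> N"
    and "\<And>x R. (x, R) \<in> \<B> \<Longrightarrow> ball x R \<subseteq> ball 0 N"
  shows "(\<Sum>p\<in>\<B>. snd p ^ 3) \<le> N ^ 3"
proof -
  have vol: "measure lebesgue (ball x R) = unit_ball_vol 3 * R ^ 3" if "0 \<le> R" for x :: "real^3" and R
    using that by (simp add: content_ball)
  have "unit_ball_vol 3 * (\<Sum>p\<in>\<B>. snd p ^ 3) = (\<Sum>p\<in>\<B>. measure lebesgue (ball (fst p) (snd p)))"
    unfolding sum_distrib_left
  proof (rule sum.cong[OF refl])
    fix p assume "p \<in> \<B>"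
    then show "unit_ball_vol 3 * snd p ^ 3 = measure lebesgue (ball (fst p) (snd p))"
      using pos[of "fst p" "snd p"] vol[of "snd p" "fst p"] by simp
  qed
  also have "\<dots> = measure lebesgue (\<Union>p\<in>\<B>. ball (fst p) (snd p))"
    using assms(1,2)
    by (intro measure_finite_Union[symmetric]) (auto simp: case_prod_unfold intro: emeasure_lborel_ball_finite[THEN less_imp_neq, THEN notE])
  also have "\<dots> \<le> measure lebesgue (ball 0 N :: (real^3) set)"
    using assms(1,5) by (intro measure_mono_fmeasurable) (fastforce intro!: sets.finite_UN)+
  also have "\<dots> = unit_ball_vol 3 * N ^ 3" using assms(4) by (rule vol)
  finally show ?thesis by (simp add: mult_le_cancel_left_pos)
qed

text \<open>After squaring and dividing by R, the error D R^3 of each ball becomes D^2 R^5. Since R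
  \<le> 1 this is at most D^2 R^3, and the cubed radii of disjoint balls in a bounded region have a
  bounded sum.\<close>

lemma small_balls_bound:
  assumes vort: "is_vorticity v w" and K0: "0 \<le> K0" and c: "0 < c"
    and fin: "finite \<B>" and disj: "disjoint_family_on (\<lambda>(x, R). ball x R) \<B>"
    and pos: "\<And>x R. (x, R) \<in> \<B> \<Longrightarrow> 0 < R \<and> R \<le> 1" and N: "0 \<le> N"
    and sub: "\<And>x R. (x, R) \<in> \<B> \<Longrightarrow> ball x R \<subseteq> ball 0 N"
    and al: "\<And>x R y. (x, R) \<in> \<B> \<Longrightarrow> y \<in> ball x (2 * R) \<Longrightarrow> c * norm (w y) \<le> w y \<bullet> e (x, R) + 2 * K0"
    and pair: "(\<Sum>(x, R)\<in>\<B>. (LINT y|lebesgue. v y \<bullet> curl (bump_field x R (e (x, R))) y)\<^sup>2 / R) \<le> M"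
  shows "(c * exp (- 1 / 3))\<^sup>2 * (\<Sum>p\<in>\<B>. (ball_mass w p)\<^sup>2 / snd p) \<le>
    2 * M + 2 * (16 * unit_ball_vol 3 * K0)\<^sup>2 * N ^ 3"
proof -
  define b where "b p = (LINT y|lebesgue. v y \<bullet> curl (bump_field (fst p) (snd p) (e p)) y)" for p
  define D where "D = 16 * unit_ball_vol 3 * K0"
  have D: "0 \<le> D" using K0 by (simp add: D_def)
  let ?k = "c * exp (- 1 / 3)"
  have each: "?k\<^sup>2 * ((ball_mass w p)\<^sup>2 / snd p) \<le> 2 * ((b p)\<^sup>2 / snd p) + 2 * D\<^sup>2 * snd p ^ 3" if p: "p \<in> \<B>" for p
  proof -
    obtain x R where xR: "p = (x, R)" by fastforce
    then have R: "0 < R" "R \<le> 1" using pos p by auto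
    have "?k * ball_mass w p \<le> \<bar>b p\<bar> + D * R ^ 3"
      using vorticity_ball_le[OF vort R(1) K0 c al] p xR by (simp add: ball_mass_def b_def D_def)
    then have "(?k * ball_mass w p)\<^sup>2 \<le> (\<bar>b p\<bar> + D * R ^ 3)\<^sup>2"
      using c ball_mass_nonneg by (intro power_mono) auto
    also have "\<dots> \<le> 2 * (b p)\<^sup>2 + 2 * (D * R ^ 3)\<^sup>2"
      using sum_squares_bound[of "\<bar>b p\<bar>" "D * R ^ 3"] by (simp add: power2_sum)
    finally have "(?k * ball_mass w p)\<^sup>2 / R \<le> (2 * (b p)\<^sup>2 + 2 * (D * R ^ 3)\<^sup>2) / R"
      using R by (intro divide_right_mono) auto
    also have "\<dots> = 2 * ((b p)\<^sup>2 / R) + 2 * D\<^sup>2 * (R ^ 3 * R ^ 2)"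
      using R by (simp add: field_simps power2_eq_square power3_eq_cube)
    also have "\<dots> \<le> 2 * ((b p)\<^sup>2 / R) + 2 * D\<^sup>2 * (R ^ 3 * 1)"
      using R by (intro add_left_mono mult_left_mono) (auto simp: power_le_one)
    finally show ?thesis by (simp add: xR power_mult_distrib)
  qed
  have "?k\<^sup>2 * (\<Sum>p\<in>\<B>. (ball_mass w p)\<^sup>2 / snd p) \<le> (\<Sum>p\<in>\<B>. 2 * ((b p)\<^sup>2 / snd p) + 2 * D\<^sup>2 * snd p ^ 3)"
    unfolding sum_distrib_left by (rule sum_mono) (rule each)
  also have "\<dots> = 2 * (\<Sum>p\<in>\<B>. (b p)\<^sup>2 / snd p) + 2 * D\<^sup>2 * (\<Sum>p\<in>\<B>. snd p ^ 3)"
    by (simp only: sum.distrib sum_distrib_left)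
  also have "\<dots> \<le> 2 * M + 2 * D\<^sup>2 * N ^ 3"
    using pair pos by (intro add_mono mult_left_mono sum_cubed_radii_le[OF fin disj _ N sub])
      (auto simp: b_def case_prod_unfold)
  finally show ?thesis by (simp add: D_def)
qed

text \<open>Removes the restriction to radii at most \<open>\<rho>\<close>. A single ball of radius
  \<open>\<rho>\<close> is an admissible collection, so each of the finitely many cells has bounded
  mass, and so has the whole region; balls larger than \<open>\<rho>\<close> are then controlled by
  this total mass alone.\<close>

lemma all_balls_bound:
  fixes w :: "real^3 \<Rightarrow> real^3"
  assumes w: "L1_loc w" and \<rho>: "0 < \<rho>" and N: "0 \<le> N" and C: "0 \<le> C"
    and cover: "finite (Z :: (real^3) set)" "Z \<subseteq> ball 0 N" "ball 0 N \<subseteq> (\<Union>z\<in>Z. ball z \<rho>)"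
    and small: "\<And>\<B>. finite \<B> \<Longrightarrow> disjoint_family_on (\<lambda>(x, R). ball x R) \<B> \<Longrightarrow>
        (\<And>x R. (x, R) \<in> \<B> \<Longrightarrow> 0 < R \<and> R \<le> \<rho> \<and> norm x < N) \<Longrightarrow>
        (\<Sum>p\<in>\<B>. (ball_mass w p)\<^sup>2 / snd p) \<le> C"
    and fin: "finite \<B>" and disj: "disjoint_family_on (\<lambda>(x, R). ball x R) \<B>"
    and \<B>: "\<And>x R. (x, R) \<in> \<B> \<Longrightarrow> 0 < R \<and> ball x R \<subseteq> ball 0 N"
  shows "(\<Sum>p\<in>\<B>. (ball_mass w p)\<^sup>2 / snd p) \<le> C + (card Z * sqrt (\<rho> * C))\<^sup>2 / \<rho>"
proof -
  have centre: "norm x < N" if "(x, R) \<in> \<B>" for x R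
    using \<B>[OF that] by (auto simp: subset_iff)
  \<comment> \<open>A cell may stick out of \<open>ball 0 N\<close>; the hypothesis
    \<open>small\<close> restricts only its centre and its radius.\<close>
  have cell: "ball_mass w (z, \<rho>) \<le> sqrt (\<rho> * C)" if "z \<in> Z" for z
  proof (rule real_le_rsqrt)
    have "(ball_mass w (z, \<rho>))\<^sup>2 / \<rho> \<le> C"
      using small[of "{(z, \<rho>)}"] \<rho> cover(2) that by (auto simp: disjoint_family_on_def)
    then show "(ball_mass w (z, \<rho>))\<^sup>2 \<le> \<rho> * C" using \<rho> by (simp add: field_simps)
  qed
  have total: "ball_mass w (0, N) \<le> card Z * sqrt (\<rho> * C)"
  proof -
    have "ball_mass w (0, N) \<le> (LINT y|lebesgue. (\<Sum>z\<in>Z. indicat_real (ball z \<rho>) y * norm (w y)))"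
      unfolding ball_mass_def fst_conv snd_conv
    proof (rule integral_mono)
      fix y
      show "indicat_real (ball 0 N) y * norm (w y) \<le> (\<Sum>z\<in>Z. indicat_real (ball z \<rho>) y * norm (w y))"
      proof (cases "y \<in> ball 0 N")
        case True
        then obtain z where z: "z \<in> Z" "y \<in> ball z \<rho>" using cover(3) by auto
        have "indicat_real (ball z \<rho>) y * norm (w y) \<le> (\<Sum>z\<in>Z. indicat_real (ball z \<rho>) y * norm (w y))"
          by (rule member_le_sum[OF z(1)]) (auto simp: cover(1))
        then show ?thesis using z(2) True by simp
      qed (simp add: sum_nonneg)
    qed (intro Bochner_Integration.integrable_sum L1_loc_integrable_ball[OF w])+
    also have "\<dots> = (\<Sum>z\<in>Z. ball_mass w (z, \<rho>))"
      unfolding ball_mass_def fst_conv snd_conv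
      by (rule Bochner_Integration.integral_sum) (rule L1_loc_integrable_ball[OF w])
    also have "\<dots> \<le> card Z * sqrt (\<rho> * C)"
      using sum_bounded_above[of Z "\<lambda>z. ball_mass w (z, \<rho>)"] cell by simp
    finally show ?thesis .
  qed
  let ?S = "{p \<in> \<B>. snd p \<le> \<rho>}" and ?L = "{p \<in> \<B>. \<rho> < snd p}"
  have "\<B> = ?S \<union> ?L" by auto
  then have "(\<Sum>p\<in>\<B>. (ball_mass w p)\<^sup>2 / snd p) = (\<Sum>p\<in>?S. (ball_mass w p)\<^sup>2 / snd p) + (\<Sum>p\<in>?L. (ball_mass w p)\<^sup>2 / snd p)"
    using fin by (subst sum.union_disjoint[symmetric]) auto
  also have "(\<Sum>p\<in>?S. (ball_mass w p)\<^sup>2 / snd p) \<le> C"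
  proof (rule small)
    show "disjoint_family_on (\<lambda>(x, R). ball x R) ?S" using disj by (rule disjoint_family_on_mono[rotated]) auto
  qed (use fin \<B> centre in auto)
  \<comment> \<open>One of the two mass factors is bounded by the total mass and 1 / R by 1 /
    \<rho>. What remains is a sum of masses of disjoint balls, again at most the total mass.\<close>
  also have "(\<Sum>p\<in>?L. (ball_mass w p)\<^sup>2 / snd p) \<le> (\<Sum>p\<in>?L. ball_mass w (0, N) / \<rho> * ball_mass w p)"
  proof (rule sum_mono)
    fix p assume p: "p \<in> ?L"
    have "(\<Sum>q\<in>{p}. ball_mass w q) \<le> ball_mass w (0, N)"
      by (rule sum_ball_mass_le[OF _ _ w]) (use p \<B> in \<open>auto simp: disjoint_family_on_def\<close>)
    then have "(ball_mass w p)\<^sup>2 \<le> ball_mass w (0, N) * ball_mass w p"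
      using mult_right_mono[OF _ ball_mass_nonneg[of w p]] by (simp add: power2_eq_square)
    then have "(ball_mass w p)\<^sup>2 / snd p \<le> (ball_mass w (0, N) * ball_mass w p) / \<rho>"
      using p \<rho> ball_mass_nonneg by (intro frac_le mult_nonneg_nonneg) auto
    then show "(ball_mass w p)\<^sup>2 / snd p \<le> ball_mass w (0, N) / \<rho> * ball_mass w p" by simp
  qed
  also have "\<dots> = ball_mass w (0, N) / \<rho> * (\<Sum>p\<in>?L. ball_mass w p)" by (simp only: sum_distrib_left)
  also have "\<dots> \<le> ball_mass w (0, N) / \<rho> * ball_mass w (0, N)"
  proof (intro mult_left_mono sum_ball_mass_le[OF _ _ w])
    show "disjoint_family_on (\<lambda>(x, R). ball x R) ?L" using disj by (rule disjoint_family_on_mono[rotated]) auto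
  qed (use fin \<B> \<rho> ball_mass_nonneg in auto)
  also have "\<dots> = (ball_mass w (0, N))\<^sup>2 / \<rho>" by (simp add: power2_eq_square)
  also have "\<dots> \<le> (card Z * sqrt (\<rho> * C))\<^sup>2 / \<rho>"
    using total \<rho> ball_mass_nonneg by (intro divide_right_mono power_mono) auto
  finally show ?thesis by simp
qed

text \<open>In the extended nonnegative reals an infinite sum is the supremum of its finite partial
  sums, and a part of a ball collection is a ball collection, so bounding finite collections
  suffices.\<close>

lemma V_norm_le:
  assumes w: "L1_loc w" and C: "0 \<le> C"
    and bound: "\<And>\<B>. finite \<B> \<Longrightarrow> ball_collection R\<^sub>0 \<Omega> \<B> \<Longrightarrow> (\<Sum>p\<in>\<B>. (ball_mass w p)\<^sup>2 / snd p) \<le> C"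
  shows "V_norm R\<^sub>0 \<Omega> w \<le> ennreal (sqrt C)"
proof -
  have sq: "V_norm_sq R\<^sub>0 \<Omega> w \<le> ennreal C"
    unfolding V_norm_sq_def
  proof (rule SUP_least, clarify)
    fix \<B> assume \<B>: "ball_collection R\<^sub>0 \<Omega> \<B>"
    let ?f = "\<lambda>(x, R). ennreal (1 / R) * (\<integral>\<^sup>+ y\<in>ball x R. ennreal (norm (w y)) \<partial>lebesgue)\<^sup>2"
    have "infsum ?f \<B> = (SUP F\<in>{F. finite F \<and> F \<subseteq> \<B>}. sum ?f F)"
      by (rule nonneg_infsum_complete) simp
    also have "\<dots> \<le> ennreal C"
    proof (rule SUP_least, clarify)
      fix F assume F: "finite F" "F \<subseteq> \<B>"
      then have coll: "ball_collection R\<^sub>0 \<Omega> F"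
        using \<B> unfolding ball_collection_def by (blast intro: disjoint_family_on_mono)
      have "sum ?f F = (\<Sum>p\<in>F. ennreal ((ball_mass w p)\<^sup>2 / snd p))"
      proof (rule sum.cong[OF refl])
        fix p assume "p \<in> F"
        then have "0 < snd p" using coll by (auto simp: ball_collection_def)
        then show "?f p = ennreal ((ball_mass w p)\<^sup>2 / snd p)"
          using ball_mass_nonneg[of w p]
          by (simp add: case_prod_unfold nn_integral_ball_mass[OF w] ennreal_power flip: ennreal_mult)
      qed
      also have "\<dots> = ennreal (\<Sum>p\<in>F. (ball_mass w p)\<^sup>2 / snd p)"
        using coll by (intro sum_ennreal) (auto simp: ball_collection_def intro!: divide_nonneg_pos)
      also have "\<dots> \<le> ennreal C" by (intro ennreal_leI bound F coll)
      finally show "sum ?f F \<le> ennreal C" .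
    qed
    finally show "infsum ?f \<B> \<le> ennreal C" .
  qed
  then have "V_norm_sq R\<^sub>0 \<Omega> w \<noteq> \<infinity>" by (auto simp: top_unique)
  moreover have "enn2real (V_norm_sq R\<^sub>0 \<Omega> w) \<le> C"
    using enn2real_mono[OF sq] C by simp
  ultimately show ?thesis
    by (simp add: V_norm_def ennreal_leI)
qed

lemma ball_mass_eq_0:
  assumes "ball (fst p) (snd p) \<inter> support_of w = {}"
  shows "ball_mass w p = 0"
proof -
  have "indicat_real (ball (fst p) (snd p)) y * norm (w y) = 0" for y
  proof (cases "y \<in> ball (fst p) (snd p)")
    case True
    then have "y \<notin> support_of w" using assms by blast
    then show ?thesis by (simp add: support_of_eq_0)
  qed simp
  then show ?thesis unfolding ball_mass_def by (simp only: Bochner_Integration.integral_zero)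
qed

theorem theorem4p2:
  fixes T R\<^sub>0 :: real and E :: "real set"
    and u \<omega> :: "real \<Rightarrow> real \<Rightarrow> real^3 \<Rightarrow> real^3"
  assumes "0 < T" and "0 < R\<^sub>0" and "R\<^sub>0 < 1/2"
    and "approximate_solutions T E u"
    and "\<And>\<epsilon> t. \<epsilon> \<in> E \<Longrightarrow> t \<in> {0..T} \<Longrightarrow> is_vorticity (u \<epsilon> t) (\<omega> \<epsilon> t)"
    and "\<And>\<epsilon> t. \<epsilon> \<in> E \<Longrightarrow> t \<in> {0..T} \<Longrightarrow> compact (support_of (\<omega> \<epsilon> t))"
    and "locally_aligned T E \<omega>"
  shows "\<forall>\<Omega> :: (real^3) set.
    bounded \<Omega> \<or> (\<exists>K. compact K \<and> (\<forall>\<epsilon>\<in>E. \<forall>t\<in>{0..T}. support_of (\<omega> \<epsilon> t) \<subseteq> K)) \<longrightarrow>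
    (\<exists>Const\<^sub>T :: real. \<forall>\<epsilon>\<in>E. \<forall>t\<in>{0..T}. V_norm R\<^sub>0 \<Omega> (\<omega> \<epsilon> t) \<le> ennreal Const\<^sub>T)"
proof (intro allI impI)
  fix \<Omega> :: "(real^3) set"
  assume "bounded \<Omega> \<or> (\<exists>K. compact K \<and> (\<forall>\<epsilon>\<in>E. \<forall>t\<in>{0..T}. support_of (\<omega> \<epsilon> t) \<subseteq> K))"
  \<comment> \<open>Both alternatives have the same effect: a point of the support of the vorticity
    that lies in a ball inside \<open>\<Omega>\<close> has norm at most \<open>N0\<close>.\<close>
  then obtain N0 where N0: "0 < N0"
    "(\<forall>x\<in>\<Omega>. norm x \<le> N0) \<or> (\<forall>\<epsilon>\<in>E. \<forall>t\<in>{0..T}. \<forall>x\<in>support_of (\<omega> \<epsilon> t). norm x \<le> N0)"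
    by (meson bounded_pos compact_imp_bounded subsetD)
  define N where "N = N0 + 2"
  have N: "0 \<le> N" using N0 by (simp add: N_def)
  \<comment> \<open>A doubled ball with centre in \<open>ball 0 N\<close> and radius at most 1
    reaches no further than N + 2.\<close>
  obtain M where M: "0 \<le> M"
    "\<And>\<epsilon> t \<B> e. \<lbrakk>\<epsilon> \<in> E; t \<in> {0..T}; finite \<B>; \<And>x R. (x, R) \<in> \<B> \<Longrightarrow> 0 < R;
      disjoint_family_on (\<lambda>(x, R). ball x R) \<B>; \<And>x R. (x, R) \<in> \<B> \<Longrightarrow> ball x (2 * R) \<subseteq> cball 0 (N + 2);
      \<And>p. norm (e p) \<le> 1\<rbrakk> \<Longrightarrow>
      (\<Sum>(x, R)\<in>\<B>. (LINT y|lebesgue. u \<epsilon> t y \<bullet> curl (bump_field x R (e (x, R))) y)\<^sup>2 / R) \<le> M"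
    by (rule pairing_square_sum_le_all_times[OF assms(1,4) compact_cball[of 0 "N + 2"]]) (rule that; blast)
  obtain K0 \<delta> c where A: "0 < K0" "0 < \<delta>" "0 < c" "c \<le> 1"
    "\<And>\<epsilon> t x R. \<epsilon> \<in> E \<Longrightarrow> t \<in> {0..T} \<Longrightarrow> 4 * R \<le> \<delta> \<Longrightarrow>
      \<exists>e. norm e \<le> 1 \<and> (\<forall>y\<in>ball x (2 * R). c * norm (\<omega> \<epsilon> t y) \<le> \<omega> \<epsilon> t y \<bullet> e + 2 * K0)"
    using locally_aligned_direction[OF assms(7)] by metis
  \<comment> \<open>The bound \<delta> / 4 makes alignment available on doubled balls; the bound 1
    keeps the doubled balls inside radius N + 2 and lets R^5 be estimated by R^3.\<close>
  define \<rho> where "\<rho> = min 1 (\<delta> / 4)"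
  have \<rho>: "0 < \<rho>" "\<rho> \<le> 1" "4 * \<rho> \<le> \<delta>" using A(2) by (auto simp: \<rho>_def)
  obtain Z where Z: "finite Z" "Z \<subseteq> ball 0 N" "ball 0 N \<subseteq> (\<Union>z\<in>Z. ball (z :: real^3) \<rho>)"
  proof -
    \<comment> \<open>Compactness is that of the closed ball, but the centres have to lie in the
      open one, because the small-ball bound asks for \<open>norm x < N\<close>.\<close>
    have "cball (0 :: real^3) N \<subseteq> (\<Union>z\<in>ball 0 N. ball z \<rho>)"
    proof
      fix x :: "real^3" assume "x \<in> cball 0 N"
      then have "x \<in> closure (ball 0 N)" using N0(1) by (simp add: N_def)
      then obtain z where "z \<in> ball 0 N" "dist z x < \<rho>" using \<rho>(1) unfolding closure_approachable by blast
      then show "x \<in> (\<Union>z\<in>ball 0 N. ball z \<rho>)" by auto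
    qed
    then obtain Z where "Z \<subseteq> ball 0 N" "finite Z" "cball (0 :: real^3) N \<subseteq> (\<Union>z\<in>Z. ball z \<rho>)"
      by (rule compactE_image[OF compact_cball, rotated]) auto
    then show ?thesis using that[of Z] ball_subset_cball by blast
  qed
  define k where "k = (c * exp (- 1 / 3))\<^sup>2"
  have k: "0 < k" using A by (simp add: k_def)
  \<comment> \<open>Here N + 2 replaces N because a small ball centred in \<open>ball 0 N\<close>
    need not be contained in it.\<close>
  define C where "C = (2 * M + 2 * (16 * unit_ball_vol 3 * K0)\<^sup>2 * (N + 2) ^ 3) / k"
  have C: "0 \<le> C" using M(1) N k by (simp add: C_def)
  define C' where "C' = C + (card Z * sqrt (\<rho> * C))\<^sup>2 / \<rho>"
  have C': "0 \<le> C'" using C \<rho> by (simp add: C'_def)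
  have "V_norm R\<^sub>0 \<Omega> (\<omega> \<epsilon> t) \<le> ennreal (sqrt C')" if \<epsilon>t: "\<epsilon> \<in> E" "t \<in> {0..T}" for \<epsilon> t
  proof -
    let ?w = "\<omega> \<epsilon> t"
    have vort: "is_vorticity (u \<epsilon> t) ?w" by (rule assms(5)[OF \<epsilon>t])
    then have w: "L1_loc ?w" by (simp add: is_vorticity_def)
    have small: "(\<Sum>p\<in>\<B>. (ball_mass ?w p)\<^sup>2 / snd p) \<le> C"
      if fin: "finite \<B>" and disj: "disjoint_family_on (\<lambda>(x, R). ball x R) \<B>"
        and \<B>: "\<And>x R. (x, R) \<in> \<B> \<Longrightarrow> 0 < R \<and> R \<le> \<rho> \<and> norm x < N" for \<B>
    proof -
      \<comment> \<open>Stated for every pair \<open>p\<close>, so that the chosen \<open>e\<close>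
        has norm at most 1 also off \<open>\<B>\<close>, as the bound by \<open>M\<close>
        demands.\<close>
      have "\<exists>e. norm e \<le> 1 \<and> (p \<in> \<B> \<longrightarrow> (\<forall>y\<in>ball (fst p) (2 * snd p). c * norm (?w y) \<le> ?w y \<bullet> e + 2 * K0))" for p
      proof (cases "p \<in> \<B>")
        case True
        then have "4 * snd p \<le> \<delta>" using \<B>[of "fst p" "snd p"] \<rho>(3) by auto
        then show ?thesis using A(5)[OF \<epsilon>t] by blast
      qed (auto intro: exI[of _ 0])
      then obtain e where e: "\<And>p. norm (e p) \<le> 1"
        "\<And>p y. p \<in> \<B> \<Longrightarrow> y \<in> ball (fst p) (2 * snd p) \<Longrightarrow> c * norm (?w y) \<le> ?w y \<bullet> e p + 2 * K0"
        by metis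
      have sub: "ball x (2 * R) \<subseteq> ball 0 (N + 2)" if "(x, R) \<in> \<B>" for x R
        using \<B>[OF that] \<rho>(2) by (simp add: ball_subset_ball_iff)
      have "k * (\<Sum>p\<in>\<B>. (ball_mass ?w p)\<^sup>2 / snd p) \<le> 2 * M + 2 * (16 * unit_ball_vol 3 * K0)\<^sup>2 * (N + 2) ^ 3"
        unfolding k_def
      proof (rule small_balls_bound[OF vort _ A(3) fin disj])
        show "ball x R \<subseteq> ball 0 (N + 2)" if "(x, R) \<in> \<B>" for x R
          using \<B>[OF that] \<rho>(2) by (simp add: ball_subset_ball_iff)
        show "(\<Sum>(x, R)\<in>\<B>. (LINT y|lebesgue. u \<epsilon> t y \<bullet> curl (bump_field x R (e (x, R))) y)\<^sup>2 / R) \<le> M"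
          by (rule M(2)[OF \<epsilon>t fin _ disj _ e(1)]) (use \<B> sub ball_subset_cball in blast)+
        show "0 < R \<and> R \<le> 1" if "(x, R) \<in> \<B>" for x R
          using \<B>[OF that] \<rho>(2) by simp
        show "c * norm (?w y) \<le> ?w y \<bullet> e (x, R) + 2 * K0" if "(x, R) \<in> \<B>" "y \<in> ball x (2 * R)" for x R y
          using e(2)[OF that(1)] that(2) by simp
      qed (use A(1) N in auto)
      then show ?thesis using k by (simp add: C_def pos_le_divide_eq mult.commute)
    qed
    show ?thesis
    proof (rule V_norm_le[OF w C'])
      fix \<B> assume fin: "finite \<B>" and coll: "ball_collection R\<^sub>0 \<Omega> \<B>"
      let ?\<B> = "{p \<in> \<B>. ball (fst p) (snd p) \<subseteq> ball 0 N}"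
      \<comment> \<open>A ball of diameter below 1 that meets the support stays within distance 1 of
        a point of norm at most \<open>N0\<close>, hence inside \<open>ball 0 N\<close>; all other
        balls have mass 0.\<close>
      have zero: "ball_mass ?w p = 0" if "p \<in> \<B> - ?\<B>" for p
      proof (rule ball_mass_eq_0, rule ccontr)
        assume "ball (fst p) (snd p) \<inter> support_of ?w \<noteq> {}"
        then obtain z where z: "z \<in> ball (fst p) (snd p)" "z \<in> support_of ?w" by auto
        have "p \<in> \<B>" using that by simp
        then have p: "snd p < 1/2" "ball (fst p) (snd p) \<subseteq> \<Omega>"
          using bspec[OF conjunct1[OF coll[unfolded ball_collection_def]]] assms(3)
          by (fastforce simp: case_prod_unfold)+
        then have "norm z \<le> N0" using N0(2) z \<epsilon>t by blast
        have "y \<in> ball 0 N" if "y \<in> ball (fst p) (snd p)" for y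
        proof -
          have "dist y z < 1" using that z(1) p(1) dist_triangle2[of y z "fst p"] by (simp add: dist_commute)
          then show ?thesis
            using \<open>norm z \<le> N0\<close> norm_triangle_sub[of y z] by (simp add: N_def dist_norm)
        qed
        then show False using that by auto
      qed
      have "(\<Sum>p\<in>\<B>. (ball_mass ?w p)\<^sup>2 / snd p) = (\<Sum>p\<in>?\<B>. (ball_mass ?w p)\<^sup>2 / snd p)"
        using fin zero by (intro sum.mono_neutral_right) auto
      also have "\<dots> \<le> C'"
        unfolding C'_def
      proof (rule all_balls_bound[OF w \<rho>(1) N C Z small])
        show "disjoint_family_on (\<lambda>(x, R). ball x R) ?\<B>"
          using coll unfolding ball_collection_def by (auto intro: disjoint_family_on_mono[rotated])
        show "0 < R \<and> ball x R \<subseteq> ball 0 N" if "(x, R) \<in> ?\<B>" for x R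
          using that coll by (auto simp: ball_collection_def)
      qed (use fin in auto)
      finally show "(\<Sum>p\<in>\<B>. (ball_mass ?w p)\<^sup>2 / snd p) \<le> C'" .
    qed
  qed
  then show "\<exists>Const\<^sub>T :: real. \<forall>\<epsilon>\<in>E. \<forall>t\<in>{0..T}. V_norm R\<^sub>0 \<Omega> (\<omega> \<epsilon> t) \<le> ennreal Const\<^sub>T" by blast
qed

end
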